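(* For all $x\in E$ and for all $\alpha\in\partial_mE$, $\mathbb{Q}_x^\alpha$-almost every trajectory tends to $\alpha$ at infinity, i.e. $X_n\to\alpha$ in the Martin compactification $\overline{E}$ as $n\to\infty$, $\mathbb{Q}^\alpha_x$-almost everywhere.
   Context: $E$ is a countable set, $(X_n)_{n\geq 0}$ is the canonical process on $E^{\mathbb{N}_0}$, $(\mathcal{F}_n)_{n\geq 0}$ its natural filtration, and $\mathcal{F}_\infty$ the $\sigma$-algebra generated by $(X_n)_{n \geq 0}$. $(\mathbb{P}_x)_{x \in E}$ is the family of laws on $(E^{\mathbb{N}_0},\mathcal{F}_\infty)$ of a Markov chain with transition probabilities $(p_{y,z})_{y,z\in E}$ in $[0,1]$: for all $k\ge 0$ and $x_0,\dots,x_k\in E$, $\mathbb{P}_x(X_0=x_0,\dots,X_k=x_k)=\mathbf{1}_{x_0=x}\,p_{x_0,x_1}\cdots p_{x_{k-1},x_k}$. $\mathbb{E}_x$ is the expectation under $\mathbb{P}_x$. Standing assumptions: (a) for all $x \in E$, $p_{x,y}=0$ for all but finitely many $y\in E$; (b) the chain is irreducible: for all $x,y \in E$ there is $n\geq 0$ with $\mathbb{P}_x(X_n=y)>0$; (c) the chain is recurrent: for all $x\in E$, $\mathbb{P}_x(\sum_{n\ge0}\mathbf{1}_{X_n=x}=\infty)=1$. For a measure $\mathbb{Q}$ and a nonnegative measurable functional $H$, $\mathbb{Q}(H)$ (or $\mathbb{Q}[H]$) denotes the integral of $H$ with respect to $\mathbb{Q}$. The measures $\mathbb{Q}^{x_0,\varphi}_x$: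 for $x_0\in E$ and $\varphi:E\to\mathbb{R}_+$ with $\varphi(x_0)=0$ and $\mathbb{E}_x[\varphi(X_1)]=\varphi(x)$ for all $x\ne x_0$, $\mathbb{Q}^{x_0,\varphi}_x$ is the unique $\sigma$-finite measure on $(E^{\mathbb{N}_0},\mathcal{F}_\infty)$ such that $\mathbb{Q}^{x_0,\varphi}_x(\sum_{n\ge1}\mathbf{1}_{X_n=y}=\infty)=0$ for all $y\in E$, and $\mathbb{Q}^{x_0,\varphi}_x(F_n\mathbf{1}_{\forall k\ge n, X_k\ne x_0})=\mathbb{E}_x[F_n\varphi(X_n)]$ for all $n\ge0$ and all nonnegative $\mathcal{F}_n$-measurable $F_n$ (existence and uniqueness are known). Martin boundary of the recurrent chain: let $L^y_n$ be the number of $k\in\{0,\dots,n\}$ with $X_k=y$, and $T'_{x_0}:=\inf\{n\ge1: X_n=x_0\}$. Set $G_{x_0}(x,y):=\mathbb{E}_x[L^y_{T'_{x_0}-1}]$, which is finite, with $G_{x_0}(x_0,y)>0$, and $L_{x_0}(x,y):=G_{x_0}(x,y)/G_{x_0}(x_0,y)$. One has $D_{x_0}(z):=\sup_{y\in E}L_{x_0}(z,y)<\infty$. For a summable family $w=(w_z)_{z\in E}$ of strictly positive reals, define the distance on $E$ $$\delta_{x_0,w}(x,y):=\sum_{z\in E}w_z\frac{|L_{x_0}(z,x)-L_{x_0}(z,y)|+|\mathbf{1}_{z=x}-\mathbf{1}_{z=y}|}{D_{x_0}(z)+1}.$$ The Martin compactification $\overline{E}$ is the topological space given by the completion of $(E,\delta_{x_0,w})$;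 it is known that it does not depend (up to canonical homeomorphism) on $x_0$ and $w$. The Martin boundary is $\partial E:=\overline{E}\setminus E$. For each $x\in E$, $L_{x_0}(x,\cdot)$ extends by continuity to $\overline{E}$. The minimal boundary $\partial_mE$ is the set of $\alpha\in\partial E$ such that $h:x\mapsto L_{x_0}(x,\alpha)$ is minimal harmonic for the transitions $(p_{x,y}\mathbf{1}_{y\ne x_0})_{x,y\in E}$, i.e. $h(x)=\sum_{y}p_{x,y}\mathbf{1}_{y\ne x_0}h(y)$ for all $x\in E$, and for every function $\psi$ harmonic for these transitions with $0\le\psi\le h$ there is $c\in[0,1]$ with $\psi=ch$. It is known that $\partial_mE$ is a Borel subset of $\partial E$ not depending on $x_0$. $\beta:E\to\mathbb{R}_+$ is a stationary measure of the chain with a fixed normalization: $\beta(y)=\sum_{x\in E}p_{x,y}\beta(x)$ for all $y\in E$, $\beta$ not identically zero; it is unique up to a multiplicative constant and never vanishes. For $\alpha\in\partial_mE$ and $x_0\in E$, let $\varphi_{x_0,\alpha}(x):=\frac{L_{x_0}(x,\alpha)}{\beta(x_0)}\mathbf{1}_{x\ne x_0}$; it vanishes at $x_0$ and is harmonic at every other point, and $\mathbb{Q}_x^{\alpha}:=\mathbb{Q}_x^{x_0,\varphi_{x_0,\alpha}}$ does not depend on the choice of $x_0\in E$. *)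

theory Defs
  imports "HOL-Probability.Probability"
begin

text \<open>
  The countable state space E is the type \<^typ>\<open>'a::countable\<close>; trajectories are functions
  \<^typ>\<open>nat \<Rightarrow> 'a\<close>, and the canonical process at time \<open>n\<close> is \<open>\<lambda>X. X n\<close>.
\<close>

section \<open>The Markov chain\<close>

definition path_space :: "(nat \<Rightarrow> 'a::countable) measure" where
  "path_space = PiM UNIV (\<lambda>_. count_space UNIV)"

definition natural_filtration :: "nat \<Rightarrow> (nat \<Rightarrow> 'a::countable) measure" where
  "natural_filtration n = sigma UNIV {{X. X k \<in> A} | k A. k \<le> n}"

text \<open>
  That the rows of \<open>p\<close> sum to one is not assumed separately: it follows from \<open>P x\<close> being a
  probability measure and the cylinder formula.
\<close>

locale recurrent_chain =
  fixes p :: "'a::countable \<Rightarrow> 'a \<Rightarrow> real"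
    and P :: "'a \<Rightarrow> (nat \<Rightarrow> 'a) measure"
  assumes p_range: "\<And>x y. p x y \<in> {0..1}"
    and prob_space_P: "\<And>x. prob_space (P x)"
    and sets_P: "\<And>x. sets (P x) = sets path_space"
    and cylinder: "\<And>x k \<xi>. measure (P x) {X \<in> space (P x). \<forall>i\<le>k. X i = \<xi> i} =
                     (if \<xi> 0 = x then (\<Prod>i<k. p (\<xi> i) (\<xi> (Suc i))) else 0)"
    and finite_range: "\<And>x. finite {y. p x y \<noteq> 0}"
    and irreducible: "\<And>x y. \<exists>n. \<P>(X in P x. X n = y) > 0"
    and recurrent: "\<And>x. \<P>(X in P x. infinite {n. X n = x}) = 1"

text \<open>The sum is a \<open>has_sum\<close> since infinitely many \<open>x\<close> may have \<open>p x y > 0\<close>.\<close>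

definition stationary_measure :: "('a::countable \<Rightarrow> 'a \<Rightarrow> real) \<Rightarrow> ('a \<Rightarrow> real) \<Rightarrow> bool" where
  "stationary_measure p \<beta> \<longleftrightarrow>
     (\<forall>y. \<beta> y \<ge> 0) \<and> (\<exists>y. \<beta> y \<noteq> 0) \<and> (\<forall>y. ((\<lambda>x. p x y * \<beta> x) has_sum \<beta> y) UNIV)"

section \<open>The measures Q\<close>

text \<open>
  \<open>is_Q P x0 \<phi> x Q\<close> says that \<open>Q\<close> is the measure $\mathbb{Q}^{x_0,\varphi}_x$, i.e. it has the
  properties by which that measure is uniquely determined.
\<close>

definition is_Q :: "('a::countable \<Rightarrow> (nat \<Rightarrow> 'a) measure) \<Rightarrow> 'a \<Rightarrow> ('a \<Rightarrow> real) \<Rightarrow> 'a \<Rightarrow>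
    (nat \<Rightarrow> 'a) measure \<Rightarrow> bool" where
  "is_Q P x0 \<phi> x Q \<longleftrightarrow>
     sets Q = sets path_space \<and> sigma_finite_measure Q \<and>
     (\<forall>y. emeasure Q {X \<in> space Q. infinite {n. 1 \<le> n \<and> X n = y}} = 0) \<and>
     (\<forall>n. \<forall>F \<in> borel_measurable (natural_filtration n).
        (\<integral>\<^sup>+X. F X * indicator {X. \<forall>k\<ge>n. X k \<noteq> x0} X \<partial>Q) = (\<integral>\<^sup>+X. F X * ennreal (\<phi> (X n)) \<partial>P x))"

section \<open>The Martin kernel and the Martin compactification\<close>

definition local_time :: "'a::countable \<Rightarrow> enat \<Rightarrow> (nat \<Rightarrow> 'a) \<Rightarrow> ennreal" where
  "local_time y n X = (\<Sum>k. if enat k \<le> n \<and> X k = y then 1 else 0)"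

definition return_time :: "'a::countable \<Rightarrow> (nat \<Rightarrow> 'a) \<Rightarrow> enat" where
  "return_time x0 X = (INF n\<in>{n. 1 \<le> n \<and> X n = x0}. enat n)"

definition green :: "('a::countable \<Rightarrow> (nat \<Rightarrow> 'a) measure) \<Rightarrow> 'a \<Rightarrow> 'a \<Rightarrow> 'a \<Rightarrow> real" where
  "green P x0 x y = enn2real (\<integral>\<^sup>+X. local_time y (return_time x0 X - 1) X \<partial>P x)"

definition martin_kernel :: "('a::countable \<Rightarrow> (nat \<Rightarrow> 'a) measure) \<Rightarrow> 'a \<Rightarrow> 'a \<Rightarrow> 'a \<Rightarrow> real" where
  "martin_kernel P x0 x y = green P x0 x y / green P x0 x0 y"

definition martin_dist :: "('a::countable \<Rightarrow> (nat \<Rightarrow> 'a) measure) \<Rightarrow> 'a \<Rightarrow> ('a \<Rightarrow> real) \<Rightarrow>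
    'a \<Rightarrow> 'a \<Rightarrow> real" where
  "martin_dist P x0 w x y =
     (\<Sum>\<^sub>\<infinity>z. w z * (\<bar>martin_kernel P x0 z x - martin_kernel P x0 z y\<bar>
                  + \<bar>of_bool (z = x) - of_bool (z = y)\<bar>)
              / ((SUP u. martin_kernel P x0 z u) + 1))"

text \<open>
  \<open>is_completion d M \<iota>\<close>: the metric space \<open>M\<close>, with the embedding \<open>\<iota>\<close>, is a completion of the
  space of all elements of type \<^typ>\<open>'a\<close> with the distance \<open>d\<close>.
\<close>

definition is_completion :: "('a \<Rightarrow> 'a \<Rightarrow> real) \<Rightarrow> 'b metric \<Rightarrow> ('a \<Rightarrow> 'b) \<Rightarrow> bool" where
  "is_completion d M \<iota> \<longleftrightarrow>
     mcomplete_of M \<and> range \<iota> \<subseteq> mspace M \<and>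
     (\<forall>x y. mdist M (\<iota> x) (\<iota> y) = d x y) \<and>
     mtopology_of M closure_of range \<iota> = mspace M"

text \<open>
  \<open>martin_kernel_ext P x0 M \<iota> x\<close> is the extension by continuity of \<open>martin_kernel P x0 x\<close> to the
  completion: its value at \<open>\<alpha>\<close> is the limit of \<open>martin_kernel P x0 x y\<close> as \<open>\<iota> y\<close> tends to \<open>\<alpha>\<close>.
\<close>

definition martin_kernel_ext :: "('a::countable \<Rightarrow> (nat \<Rightarrow> 'a) measure) \<Rightarrow> 'a \<Rightarrow> 'b metric \<Rightarrow>
    ('a \<Rightarrow> 'b) \<Rightarrow> 'a \<Rightarrow> 'b \<Rightarrow> real" where
  "martin_kernel_ext P x0 M \<iota> x \<alpha> =
     Lim (filtercomap \<iota> (nhdsin (mtopology_of M) \<alpha>)) (martin_kernel P x0 x)"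

definition killed_harmonic :: "('a::countable \<Rightarrow> 'a \<Rightarrow> real) \<Rightarrow> 'a \<Rightarrow> ('a \<Rightarrow> real) \<Rightarrow> bool" where
  "killed_harmonic p x0 h \<longleftrightarrow> (\<forall>x. h x = (\<Sum>y | p x y \<noteq> 0. p x y * of_bool (y \<noteq> x0) * h y))"

definition minimal_killed_harmonic :: "('a::countable \<Rightarrow> 'a \<Rightarrow> real) \<Rightarrow> 'a \<Rightarrow> ('a \<Rightarrow> real) \<Rightarrow> bool" where
  "minimal_killed_harmonic p x0 h \<longleftrightarrow>
     killed_harmonic p x0 h \<and>
     (\<forall>\<psi>. killed_harmonic p x0 \<psi> \<and> (\<forall>x. 0 \<le> \<psi> x \<and> \<psi> x \<le> h x) \<longrightarrow>
        (\<exists>c\<in>{0..1}. \<forall>x. \<psi> x = c * h x))"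

definition martin_boundary :: "'b metric \<Rightarrow> ('a \<Rightarrow> 'b) \<Rightarrow> 'b set" where
  "martin_boundary M \<iota> = mspace M - range \<iota>"

definition minimal_boundary :: "('a::countable \<Rightarrow> 'a \<Rightarrow> real) \<Rightarrow> ('a \<Rightarrow> (nat \<Rightarrow> 'a) measure) \<Rightarrow> 'a \<Rightarrow>
    'b metric \<Rightarrow> ('a \<Rightarrow> 'b) \<Rightarrow> 'b set" where
  "minimal_boundary p P x0 M \<iota> =
     {\<alpha> \<in> martin_boundary M \<iota>. minimal_killed_harmonic p x0 (\<lambda>x. martin_kernel_ext P x0 M \<iota> x \<alpha>)}"

definition boundary_fun :: "('a::countable \<Rightarrow> (nat \<Rightarrow> 'a) measure) \<Rightarrow> ('a \<Rightarrow> real) \<Rightarrow> 'a \<Rightarrow>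
    'b metric \<Rightarrow> ('a \<Rightarrow> 'b) \<Rightarrow> 'b \<Rightarrow> 'a \<Rightarrow> real" where
  "boundary_fun P \<beta> x0 M \<iota> \<alpha> x = martin_kernel_ext P x0 M \<iota> x \<alpha> / \<beta> x0 * of_bool (x \<noteq> x0)"

end

theory Submission
  imports Defs
begin

text \<open>
Killing the chain when it enters \<open>x0\<close> gives a transient kernel \<open>T\<close> with Green function \<open>G\<close>, and the
function \<open>h z = K z \<alpha>\<close> (where \<open>K z y = G z y / G x0 y\<close>) is nonnegative and minimal among the
\<open>T\<close>-harmonic functions, with \<open>h x0 = 1\<close>. Restricted to the trajectories that avoid \<open>x0\<close> from time \<open>n\<close>
on, \<open>Q\<close> is, up to the factor \<open>1 / \<beta> x0\<close>, the \<open>h\<close>-transform of the killed chain started from time \<open>n\<close>.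
The usual proof of convergence to \<open>\<alpha>\<close> goes through Doob's time reversal and the integral
representation of harmonic functions. For a minimal \<open>h\<close> the following comparison is enough.

Let \<open>C\<close> be a set of states and \<open>red C\<close> the function reduced on \<open>C\<close>, that is, \<open>h z\<close> times the probability
that the \<open>h\<close>-transform started at \<open>z\<close> hits \<open>C\<close>. If \<open>C\<close> is finite then \<open>red C z = (\<Sum>b\<in>C. G z b * e b)\<close>
with charges \<open>e b \<ge> 0\<close> that do not depend on \<open>z\<close>. So if \<open>K z y \<ge> a\<close> for all \<open>y \<in> C\<close> then
\<open>red C z \<ge> a * red C x0\<close>, and by approximation this holds for infinite \<open>C\<close> as well (lemma
\<open>reduced_comparison\<close>). Now remove larger and larger finite sets from \<open>C\<close>: the functions \<open>red\<close>
decrease to a harmonic function below \<open>h\<close>, which by minimality is \<open>c * h\<close> for a constant \<open>c\<close>, and in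
the limit the comparison reads \<open>c * h z \<ge> a * c\<close>. When \<open>a > h z\<close> this forces \<open>c = 0\<close>. The same works for
\<open>K z y \<le> a\<close> with \<open>a < h z\<close> (lemma \<open>minimal_reduced_tendsto_0\<close>).

On the other hand, \<open>Q\<close> of the trajectories that avoid \<open>x0\<close> after time \<open>n\<close> and still hit \<open>C\<close> after time
\<open>n\<close> is at most a constant times the expectation of \<open>red C (X n)\<close>; this comes from cutting at the first
hitting time (lemma \<open>escape_through_set_le\<close>). Hence \<open>Q\<close>-almost every trajectory visits \<open>C\<close> finitely
often (lemma \<open>AE_thin_set\<close>). Taking all rational \<open>a\<close> one gets \<open>K z (X n) \<longlonglongrightarrow> h z\<close> for every \<open>z\<close>. Since
the trajectory also leaves each state, and \<open>\<alpha>\<close> is not a state, the definition of the Martin distance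
gives \<open>X n \<longlonglongrightarrow> \<alpha>\<close> (lemma \<open>limitin_boundary_point\<close>).

Finiteness of \<open>G\<close>, and boundedness of \<open>K z\<close>, are read off from the stationary measure: under it the
expected number of visits to \<open>y\<close> in an excursion from \<open>x0\<close> is at most \<open>\<beta> y / \<beta> x0\<close>.
\<close>

section \<open>Potential theory of a finite-range kernel\<close>

definition transition_op :: "('a \<Rightarrow> 'a \<Rightarrow> real) \<Rightarrow> ('a \<Rightarrow> real) \<Rightarrow> 'a \<Rightarrow> real" where
  "transition_op q g x = (\<Sum>y | q x y \<noteq> 0. q x y * g y)"

locale finite_range_kernel =
  fixes q :: "'a \<Rightarrow> 'a \<Rightarrow> real"
  assumes kernel_nonneg: "q x y \<ge> 0"
    and finite_support: "finite {y. q x y \<noteq> 0}"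
begin

abbreviation T :: "('a \<Rightarrow> real) \<Rightarrow> 'a \<Rightarrow> real" where
  "T \<equiv> transition_op q"

lemma T_mono: "(\<And>y. f y \<le> g y) \<Longrightarrow> T f x \<le> T g x"
  unfolding transition_op_def by (intro sum_mono mult_left_mono kernel_nonneg) auto

lemma T_nonneg: "(\<And>y. 0 \<le> g y) \<Longrightarrow> 0 \<le> T g x"
  unfolding transition_op_def by (intro sum_nonneg mult_nonneg_nonneg kernel_nonneg) auto

lemma T_diff: "T (\<lambda>y. f y - g y) x = T f x - T g x"
  unfolding transition_op_def by (simp add: sum_subtractf algebra_simps)

lemma T_cmult: "T (\<lambda>y. c * f y) x = c * T f x"
  unfolding transition_op_def by (simp add: sum_distrib_left algebra_simps)

lemma T_sum: "T (\<lambda>y. \<Sum>b\<in>B. f b y) x = (\<Sum>b\<in>B. T (f b) x)"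
  unfolding transition_op_def sum_distrib_left by (rule sum.swap)

lemma tendsto_T:
  assumes "\<And>y. ((\<lambda>i. f i y) \<longlongrightarrow> g y) F"
  shows "((\<lambda>i. T (f i) x) \<longlongrightarrow> T g x) F"
  unfolding transition_op_def by (intro tendsto_intros assms)

lemma iterate_nonneg: "(\<And>y. 0 \<le> g y) \<Longrightarrow> 0 \<le> (T ^^ k) g x"
  by (induction k arbitrary: x) (auto intro: T_nonneg)

lemma iterate_mono: "(\<And>y. f y \<le> g y) \<Longrightarrow> (T ^^ k) f x \<le> (T ^^ k) g x"
  by (induction k arbitrary: x) (auto intro: T_mono)

lemma iterate_diff: "(T ^^ k) (\<lambda>y. f y - g y) x = (T ^^ k) f x - (T ^^ k) g x"
proof (induction k arbitrary: x)
  case (Suc k)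
  then have "(T ^^ k) (\<lambda>y. f y - g y) = (\<lambda>x. (T ^^ k) f x - (T ^^ k) g x)" by blast
  then show ?case by (simp add: T_diff)
qed simp

lemma iterate_cmult: "(T ^^ k) (\<lambda>y. c * f y) x = c * (T ^^ k) f x"
proof (induction k arbitrary: x)
  case (Suc k)
  then have "(T ^^ k) (\<lambda>y. c * f y) = (\<lambda>x. c * (T ^^ k) f x)" by blast
  then show ?case by (simp add: T_cmult)
qed simp

lemma iterate_sum: "(T ^^ k) (\<lambda>y. \<Sum>b\<in>B. f b y) x = (\<Sum>b\<in>B. (T ^^ k) (f b) x)"
proof (induction k arbitrary: x)
  case (Suc k)
  then have "(T ^^ k) (\<lambda>y. \<Sum>b\<in>B. f b y) = (\<lambda>x. \<Sum>b\<in>B. (T ^^ k) (f b) x)" by blast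
  then show ?case by (simp add: T_sum)
qed simp

lemma tendsto_iterate:
  assumes "\<And>y. ((\<lambda>i. f i y) \<longlongrightarrow> g y) F"
  shows "((\<lambda>i. (T ^^ k) (f i) x) \<longlongrightarrow> (T ^^ k) g x) F"
  by (induction k arbitrary: x) (auto intro: tendsto_T assms)

text \<open>
In probabilistic terms \<open>reduced_upto h B k x\<close> is \<open>h x\<close> times the probability that the \<open>h\<close>-transform
of the kernel, started at \<open>x\<close>, enters \<open>B\<close> by time \<open>k\<close>; its limit \<open>reduced h B\<close> is the reduced function
(balayage) of \<open>h\<close> on \<open>B\<close>.
\<close>

primrec reduced_upto :: "('a \<Rightarrow> real) \<Rightarrow> 'a set \<Rightarrow> nat \<Rightarrow> 'a \<Rightarrow> real" where
  "reduced_upto h B 0 = (\<lambda>x. if x \<in> B then h x else 0)"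
| "reduced_upto h B (Suc k) = (\<lambda>x. if x \<in> B then h x else T (reduced_upto h B k) x)"

definition reduced :: "('a \<Rightarrow> real) \<Rightarrow> 'a set \<Rightarrow> 'a \<Rightarrow> real" where
  "reduced h B x = (SUP k. reduced_upto h B k x)"

text \<open>
In \<open>k\<close> steps only finitely many states can be reached, so an infinite \<open>B\<close> may be replaced by a
finite part of it. This is how identities for finite sets are carried over to all sets.
\<close>

lemma reduced_upto_local:
  "\<exists>F. finite F \<and> (\<forall>C D. C \<inter> F = D \<inter> F \<longrightarrow> reduced_upto h C k x = reduced_upto h D k x)"
proof (induction k arbitrary: x)
  case 0
  show ?case by (intro exI[of _ "{x}"]) auto
next
  case (Suc k)
  then obtain F where F: "\<And>y. finite (F y)"
    "\<And>y C D. C \<inter> F y = D \<inter> F y \<Longrightarrow> reduced_upto h C k y = reduced_upto h D k y"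
    by metis
  let ?F = "insert x (\<Union>y\<in>{y. q x y \<noteq> 0}. F y)"
  have "reduced_upto h C (Suc k) x = reduced_upto h D (Suc k) x" if CD: "C \<inter> ?F = D \<inter> ?F" for C D
  proof -
    have "x \<in> C \<longleftrightarrow> x \<in> D" using CD by blast
    moreover have "reduced_upto h C k y = reduced_upto h D k y" if "q x y \<noteq> 0" for y
      by (rule F(2)) (use CD that in blast)
    ultimately show ?thesis by (simp add: transition_op_def)
  qed
  moreover have "finite ?F" using F(1) finite_support by auto
  ultimately show ?case by blast
qed

end

locale kernel_harmonic = finite_range_kernel +
  fixes h :: "'a \<Rightarrow> real"
  assumes h_nonneg: "0 \<le> h x"
    and h_harmonic: "T h x = h x"
begin

lemma reduced_upto_nonneg: "0 \<le> reduced_upto h B k x"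
  by (induction k arbitrary: x) (auto intro: T_nonneg h_nonneg)

lemma reduced_upto_le: "reduced_upto h B k x \<le> h x"
proof (induction k arbitrary: x)
  case (Suc k)
  have "T (reduced_upto h B k) x \<le> T h x" by (intro T_mono Suc)
  then show ?case by (simp add: h_harmonic)
qed (auto intro: h_nonneg)

lemma reduced_upto_Suc_le: "reduced_upto h B k x \<le> reduced_upto h B (Suc k) x"
proof (induction k arbitrary: x)
  case 0
  show ?case using reduced_upto_nonneg[of B 0] by (auto intro: T_nonneg)
next
  case (Suc k)
  show ?case using T_mono[of "reduced_upto h B k" "reduced_upto h B (Suc k)" x, OF Suc] by auto
qed

lemma reduced_upto_mono_set:
  assumes "B \<subseteq> C"
  shows "reduced_upto h B k x \<le> reduced_upto h C k x"
proof (induction k arbitrary: x)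
  case 0
  show ?case using assms by (auto intro: h_nonneg)
next
  case (Suc k)
  have "T (reduced_upto h B k) x \<le> h x"
    using T_mono[of "reduced_upto h B k" h x] by (simp add: reduced_upto_le h_harmonic)
  then show ?case using assms T_mono[of "reduced_upto h B k" "reduced_upto h C k" x, OF Suc] by auto
qed

lemma bdd_above_reduced_upto: "bdd_above (range (\<lambda>k. reduced_upto h B k x))"
  by (auto intro: reduced_upto_le)

lemma reduced_upto_tendsto: "(\<lambda>k. reduced_upto h B k x) \<longlonglongrightarrow> reduced h B x"
  unfolding reduced_def
  by (intro LIMSEQ_incseq_SUP bdd_above_reduced_upto incseq_SucI reduced_upto_Suc_le)

lemma reduced_upto_le_reduced: "reduced_upto h B k x \<le> reduced h B x"
  unfolding reduced_def by (intro cSUP_upper bdd_above_reduced_upto) auto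

lemma reduced_le: "reduced h B x \<le> h x"
  unfolding reduced_def by (intro cSUP_least) (auto intro: reduced_upto_le)

lemma reduced_nonneg: "0 \<le> reduced h B x"
  using reduced_upto_nonneg reduced_upto_le_reduced by (rule order_trans)

lemma reduced_mono: "B \<subseteq> C \<Longrightarrow> reduced h B x \<le> reduced h C x"
  by (rule LIMSEQ_le[OF reduced_upto_tendsto reduced_upto_tendsto]) (auto intro: reduced_upto_mono_set)

lemma reduced_on: "x \<in> B \<Longrightarrow> reduced h B x = h x"
  using reduced_upto_le_reduced[of B 0 x] reduced_le[of B x] by simp

lemma reduced_off:
  assumes "x \<notin> B"
  shows "T (reduced h B) x = reduced h B x"
proof -
  have "(\<lambda>k. T (reduced_upto h B k) x) \<longlonglongrightarrow> T (reduced h B) x"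
    by (intro tendsto_T reduced_upto_tendsto)
  moreover have "(\<lambda>k. reduced_upto h B (Suc k) x) \<longlonglongrightarrow> reduced h B x"
    using reduced_upto_tendsto by (rule LIMSEQ_Suc)
  ultimately show ?thesis using assms by (simp add: LIMSEQ_unique)
qed

lemma reduced_superharmonic: "T (reduced h B) x \<le> reduced h B x"
proof (cases "x \<in> B")
  case True
  have "T (reduced h B) x \<le> T h x" by (intro T_mono reduced_le)
  then show ?thesis using True by (simp add: h_harmonic reduced_on)
qed (simp add: reduced_off)

end

locale transient_kernel = finite_range_kernel +
  assumes green_summable: "summable (\<lambda>k. (T ^^ k) (indicator {y}) x)"
begin

definition G :: "'a \<Rightarrow> 'a \<Rightarrow> real" where
  "G x y = (\<Sum>k. (T ^^ k) (indicator {y}) x)"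

lemma G_sums: "(\<lambda>k. (T ^^ k) (indicator {y}) x) sums G x y"
  unfolding G_def using green_summable by (rule summable_sums)

lemma iterate_indicator_nonneg: "0 \<le> (T ^^ k) (indicator {y}) x"
  by (rule iterate_nonneg) simp

lemma partial_sum_le_G: "(\<Sum>k<n. (T ^^ k) (indicator {y}) x) \<le> G x y"
  unfolding G_def by (intro sum_le_suminf green_summable) (auto intro: iterate_indicator_nonneg)

lemma G_nonneg: "0 \<le> G x y"
  unfolding G_def by (intro suminf_nonneg green_summable iterate_indicator_nonneg)

lemma G_diag_ge_1: "1 \<le> G y y"
  using partial_sum_le_G[where n = 1 and x = y and y = y] by simp

lemma G_equation: "T (\<lambda>x. G x y) x = G x y - indicator {y} x"
proof -
  have "(\<lambda>n. \<Sum>k<n. (T ^^ Suc k) (indicator {y}) x) \<longlonglongrightarrow> T (\<lambda>x. G x y) x"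
    using tendsto_T[where f = "\<lambda>n x. \<Sum>k<n. (T ^^ k) (indicator {y}) x" and g = "\<lambda>x. G x y"] G_sums
    by (simp add: T_sum sums_def)
  moreover have "(\<lambda>k. (T ^^ Suc k) (indicator {y}) x) sums (G x y - indicator {y} x)"
    using G_sums[of y x] by (subst sums_Suc_iff) simp
  ultimately show ?thesis unfolding sums_def by (rule LIMSEQ_unique)
qed

lemma iterate_G: "(T ^^ n) (\<lambda>x. G x y) x = G x y - (\<Sum>k<n. (T ^^ k) (indicator {y}) x)"
proof (induction n arbitrary: x)
  case (Suc n)
  have "(T ^^ Suc n) (\<lambda>x. G x y) x = (T ^^ n) (\<lambda>x. G x y - indicator {y} x) x"
    by (simp add: funpow_Suc_right G_equation[abs_def] del: funpow.simps)
  also have "\<dots> = G x y - (\<Sum>k<Suc n. (T ^^ k) (indicator {y}) x)"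
    by (simp add: iterate_diff Suc)
  finally show ?case .
qed simp

lemma iterate_G_tendsto_0: "(\<lambda>n. (T ^^ n) (\<lambda>x. G x y) x) \<longlonglongrightarrow> 0"
  unfolding iterate_G using G_sums[of y x] by (auto simp: sums_def intro!: tendsto_eq_intros)

end

locale transient_harmonic = transient_kernel + kernel_harmonic
begin

text \<open>
The right-hand side is superharmonic and dominates \<open>h\<close> on \<open>B\<close> because \<open>G b b \<ge> 1\<close>. The bound makes the
iterates \<open>T ^^ n\<close> of the reduced function tend to zero, which is what turns it into a pure potential.
\<close>

lemma reduced_le_potential:
  assumes "finite B"
  shows "reduced h B x \<le> (\<Sum>b\<in>B. h b * G x b)"
proof -
  have on: "h y \<le> (\<Sum>b\<in>B. h b * G y b)" if "y \<in> B" for y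
  proof -
    have "h y * 1 \<le> h y * G y y" by (intro mult_left_mono G_diag_ge_1 h_nonneg)
    also have "\<dots> \<le> (\<Sum>b\<in>B. h b * G y b)"
      using assms that by (intro member_le_sum) (auto intro: mult_nonneg_nonneg h_nonneg G_nonneg)
    finally show ?thesis by simp
  qed
  have "reduced_upto h B k x \<le> (\<Sum>b\<in>B. h b * G x b)" for k
  proof (induction k arbitrary: x)
    case 0
    show ?case using on by (auto intro!: sum_nonneg mult_nonneg_nonneg h_nonneg G_nonneg)
  next
    case (Suc k)
    have "T (reduced_upto h B k) x \<le> T (\<lambda>x. \<Sum>b\<in>B. h b * G x b) x"
      by (intro T_mono Suc)
    also have "\<dots> = (\<Sum>b\<in>B. h b * (G x b - indicator {b} x))"
      by (simp add: T_sum T_cmult G_equation)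
    also have "\<dots> \<le> (\<Sum>b\<in>B. h b * G x b)"
      by (intro sum_mono mult_left_mono h_nonneg) (auto simp: indicator_def)
    finally show ?case using on by auto
  qed
  then show ?thesis unfolding reduced_def by (intro cSUP_least) auto
qed

text \<open>
Riesz decomposition without harmonic part: telescoping the iterates writes the reduced function as
the potential of its charge \<open>reduced h B - T (reduced h B)\<close>, which vanishes outside \<open>B\<close>.
\<close>

lemma reduced_finite_eq_potential:
  assumes "finite B"
  shows "reduced h B x = (\<Sum>b\<in>B. (h b - T (reduced h B) b) * G x b)"
proof -
  \<comment> \<open>the charge, a combination of point masses on \<open>B\<close>\<close>
  define e where "e = (\<lambda>x. reduced h B x - T (reduced h B) x)"
  have e_eq: "e x = (\<Sum>b\<in>B. e b * indicator {b} x)" for x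
    using assms by (cases "x \<in> B") (auto simp: e_def reduced_off indicator_def if_distrib cong: if_cong)
  have iter_e: "(T ^^ k) e x = (\<Sum>b\<in>B. e b * (T ^^ k) (indicator {b}) x)" for k
    using iterate_sum[of k "\<lambda>b x. e b * indicator {b} x" B x] e_eq[abs_def]
    by (simp add: iterate_cmult)
  have split: "reduced h B x = (\<Sum>k<n. (T ^^ k) e x) + (T ^^ n) (reduced h B) x" for n
  proof (induction n)
    case (Suc n)
    have "(T ^^ n) e x = (T ^^ n) (reduced h B) x - (T ^^ Suc n) (reduced h B) x"
      by (simp add: e_def iterate_diff funpow_Suc_right del: funpow.simps)
    then show ?case using Suc by simp
  qed simp
  have "(\<lambda>n. (T ^^ n) (reduced h B) x) \<longlonglongrightarrow> 0"
  proof (rule tendsto_sandwich)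
    show "\<forall>\<^sub>F n in sequentially. 0 \<le> (T ^^ n) (reduced h B) x"
      by (simp add: iterate_nonneg reduced_nonneg)
    show "\<forall>\<^sub>F n in sequentially. (T ^^ n) (reduced h B) x
            \<le> (\<Sum>b\<in>B. h b * (T ^^ n) (\<lambda>x. G x b) x)"
      using iterate_mono[of "reduced h B" "\<lambda>x. \<Sum>b\<in>B. h b * G x b"]
      by (simp add: reduced_le_potential[OF assms] iterate_sum iterate_cmult)
    show "(\<lambda>n. \<Sum>b\<in>B. h b * (T ^^ n) (\<lambda>x. G x b) x) \<longlonglongrightarrow> 0"
      by (intro tendsto_null_sum tendsto_mult_right_zero iterate_G_tendsto_0)
  qed simp
  then have "(\<lambda>n. reduced h B x - (T ^^ n) (reduced h B) x) \<longlonglongrightarrow> reduced h B x - 0"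
    by (intro tendsto_intros)
  moreover have "reduced h B x - (T ^^ n) (reduced h B) x = (\<Sum>k<n. (T ^^ k) e x)" for n
    using split[of n] by simp
  ultimately have "(\<lambda>k. (T ^^ k) e x) sums reduced h B x" by (simp add: sums_def)
  moreover have "(\<lambda>k. (T ^^ k) e x) sums (\<Sum>b\<in>B. e b * G x b)"
    unfolding iter_e by (intro sums_sum sums_mult G_sums)
  ultimately have "reduced h B x = (\<Sum>b\<in>B. e b * G x b)" by (rule sums_unique2)
  then show ?thesis by (simp add: e_def reduced_on)
qed

text \<open>
The charge of a finite set does not depend on the starting point, so an inequality between the
kernels \<open>G u\<close> and \<open>G v\<close> on \<open>C\<close> integrates to one between the hitting probabilities from \<open>u\<close> and \<open>v\<close>.
\<close>

lemma reduced_comparison: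
  assumes le: "\<And>y. y \<in> C \<Longrightarrow> a * G u y \<le> b * G v y" and "0 \<le> a" "0 \<le> b"
  shows "a * reduced h C u \<le> b * reduced h C v"
proof -
  have fin: "a * reduced h F u \<le> b * reduced h F v" if F: "finite F" "F \<subseteq> C" for F
  proof -
    have charge: "0 \<le> h y - T (reduced h F) y" if "y \<in> F" for y
      using reduced_superharmonic[of F y] that by (simp add: reduced_on)
    have "a * reduced h F u = (\<Sum>y\<in>F. (h y - T (reduced h F) y) * (a * G u y))"
      by (subst reduced_finite_eq_potential[OF F(1)]) (simp add: sum_distrib_left mult_ac)
    also have "\<dots> \<le> (\<Sum>y\<in>F. (h y - T (reduced h F) y) * (b * G v y))"
      using F by (intro sum_mono mult_left_mono charge le) auto
    also have "\<dots> = b * reduced h F v"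
      using reduced_finite_eq_potential[OF F(1), of v] by (simp add: sum_distrib_left mult_ac)
    finally show ?thesis .
  qed
  have "a * reduced_upto h C k u \<le> b * reduced h C v" for k
  proof -
    obtain F where F: "finite F"
      "\<And>C D. C \<inter> F = D \<inter> F \<Longrightarrow> reduced_upto h C k u = reduced_upto h D k u"
      using reduced_upto_local[of h k u] by blast
    have "reduced_upto h C k u = reduced_upto h (C \<inter> F) k u" by (rule F(2)) auto
    then have "a * reduced_upto h C k u \<le> a * reduced h (C \<inter> F) u"
      using \<open>0 \<le> a\<close> by (simp add: mult_left_mono reduced_upto_le_reduced)
    also have "\<dots> \<le> b * reduced h (C \<inter> F) v" using F(1) by (intro fin) auto
    also have "\<dots> \<le> b * reduced h C v" using \<open>0 \<le> b\<close> by (intro mult_left_mono reduced_mono) auto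
    finally show ?thesis .
  qed
  then show ?thesis
    by (intro LIMSEQ_le_const2[OF tendsto_mult_left[OF reduced_upto_tendsto]]) auto
qed

text \<open>
The limit of the reduced functions is harmonic, since each point lies outside \<open>B N\<close> for large \<open>N\<close>, and
lies below \<open>h\<close>; so it is a multiple \<open>c * h\<close>. The comparison on \<open>C\<close> passes to the limit and contradicts
the strict inequality \<open>gap\<close> unless \<open>c = 0\<close>.
\<close>

lemma minimal_reduced_tendsto_0:
  fixes B :: "nat \<Rightarrow> 'a set"
  assumes minimal: "\<And>\<psi>. (\<And>x. T \<psi> x = \<psi> x) \<Longrightarrow> (\<And>x. 0 \<le> \<psi> x) \<Longrightarrow> (\<And>x. \<psi> x \<le> h x) \<Longrightarrow>
      \<exists>c\<ge>0. \<forall>x. \<psi> x = c * h x"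
    and B: "decseq B" "\<And>y. \<exists>N. y \<notin> B N" "\<And>N. B N \<subseteq> C"
    and le: "\<And>y. y \<in> C \<Longrightarrow> a * G u y \<le> b * G v y" "0 \<le> a" "0 \<le> b"
    and gap: "b * h v < a * h u"
  shows "(\<lambda>N. reduced h (B N) x) \<longlonglongrightarrow> 0"
proof -
  define \<psi> where "\<psi> = (\<lambda>x. INF N. reduced h (B N) x)"
  have bdd: "bdd_below (range (\<lambda>N. reduced h (B N) x))" for x
    by (auto intro: reduced_nonneg)
  have lim: "(\<lambda>N. reduced h (B N) x) \<longlonglongrightarrow> \<psi> x" for x
    unfolding \<psi>_def using B(1)
    by (intro LIMSEQ_decseq_INF bdd decseq_SucI reduced_mono) (auto simp: decseq_Suc_iff)
  have "T \<psi> x = \<psi> x" for x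
  proof -
    obtain N where N: "x \<notin> B N" using B(2) by blast
    have "\<forall>\<^sub>F n in sequentially. T (reduced h (B n)) x = reduced h (B n) x"
      using eventually_ge_at_top[of N]
    proof eventually_elim
      case (elim n)
      then have "x \<notin> B n" using N B(1) by (auto simp: decseq_def)
      then show ?case by (rule reduced_off)
    qed
    then have "(\<lambda>n. reduced h (B n) x) \<longlonglongrightarrow> T \<psi> x"
      using tendsto_T[where x = x, OF lim] by (rule Lim_transform_eventually[rotated])
    then show ?thesis using lim by (rule LIMSEQ_unique)
  qed
  moreover have "0 \<le> \<psi> x" for x unfolding \<psi>_def by (intro cINF_greatest reduced_nonneg) auto
  moreover have "\<psi> x \<le> h x" for x
    by (rule LIMSEQ_le_const2[OF lim]) (auto intro: reduced_le)
  ultimately obtain c where c: "c \<ge> 0" "\<And>x. \<psi> x = c * h x" using minimal by blast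
  have "a * \<psi> u \<le> b * \<psi> v"
    by (rule LIMSEQ_le[OF tendsto_mult_left[OF lim] tendsto_mult_left[OF lim]])
      (use B(3) le in \<open>auto intro!: reduced_comparison\<close>)
  then have "c * (a * h u - b * h v) \<le> 0" by (simp add: c(2) algebra_simps)
  then have "c = 0" using gap c(1) by (auto simp: mult_le_0_iff)
  then show ?thesis using lim[of x] by (simp add: c(2))
qed

end

section \<open>The Markov property\<close>

definition path_prefix :: "nat \<Rightarrow> (nat \<Rightarrow> 'a) \<Rightarrow> 'a list" where
  "path_prefix k X = map X [0..<Suc k]"

lemma path_prefix_Suc: "path_prefix (Suc k) X = path_prefix k X @ [X (Suc k)]"
  by (simp add: path_prefix_def)

lemma length_path_prefix [simp]: "length (path_prefix k X) = Suc k"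
  by (simp add: path_prefix_def)

lemma path_prefix_nth: "i \<le> k \<Longrightarrow> path_prefix k X ! i = X i"
  unfolding path_prefix_def by (subst nth_map) (auto simp del: upt_Suc)

lemma path_prefix_eq_iff: "length l = Suc k \<Longrightarrow> path_prefix k X = l \<longleftrightarrow> (\<forall>i\<le>k. X i = l ! i)"
  by (auto simp: list_eq_iff_nth_eq path_prefix_nth less_Suc_eq_le)

lemma path_coordinate_measurable:
  assumes "sets N = sets path_space"
  shows "(\<lambda>X. X k) \<in> N \<rightarrow>\<^sub>M count_space UNIV"
  by (subst measurable_cong_sets[OF assms refl], unfold path_space_def)
    (rule measurable_component_singleton, simp)

lemma path_prefix_measurable: "path_prefix k \<in> path_space \<rightarrow>\<^sub>M count_space UNIV"
proof -
  have "path_prefix k -` {l} \<inter> space path_space \<in> sets path_space" for l :: "'a list"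
  proof (cases "length l = Suc k")
    case True
    then have "path_prefix k -` {l} \<inter> space path_space
        = {X \<in> space path_space. \<forall>i\<in>{..k}. X i = l ! i}"
      by (auto simp: path_prefix_eq_iff path_prefix_nth)
    also have "\<dots> \<in> sets path_space" unfolding path_space_def by measurable
    finally show ?thesis .
  next
    case False
    then have "path_prefix k -` {l} = {}" by auto
    then show ?thesis by simp
  qed
  then show ?thesis by (simp add: measurable_count_space_eq2_countable)
qed

lemma nn_integral_partition_countable:
  fixes Z :: "'b \<Rightarrow> 'c::countable"
  assumes [measurable]: "Z \<in> N \<rightarrow>\<^sub>M count_space UNIV" "f \<in> borel_measurable N"
  shows "(\<integral>\<^sup>+X. f X \<partial>N) = (\<integral>\<^sup>+z. \<integral>\<^sup>+X. f X * indicator {z} (Z X) \<partial>N \<partial>count_space UNIV)"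
proof -
  have "f X = (\<integral>\<^sup>+z. f X * indicator {z} (Z X) \<partial>count_space UNIV)" for X
    by (subst nn_integral_count_space'[of "{Z X}"]) auto
  then have "(\<integral>\<^sup>+X. f X \<partial>N) = (\<integral>\<^sup>+X. \<integral>\<^sup>+z. f X * indicator {z} (Z X) \<partial>count_space UNIV \<partial>N)"
    by simp
  also have "\<dots> = (\<integral>\<^sup>+z. \<integral>\<^sup>+X. f X * indicator {z} (Z X) \<partial>N \<partial>count_space UNIV)"
    by (intro nn_integral_count_space_nn_integral countableI_type) measurable
  finally show ?thesis .
qed

text \<open>
Since the state space is discrete, a functional that depends only on the coordinates up to time \<open>k\<close>
is automatically measurable; this is easier to check than measurability for the natural filtration.
\<close>

definition adapted :: "nat \<Rightarrow> ((nat \<Rightarrow> 'a) \<Rightarrow> 'b) \<Rightarrow> bool" where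
  "adapted k F \<longleftrightarrow> (\<forall>X Y. (\<forall>i\<le>k. X i = Y i) \<longrightarrow> F X = F Y)"

lemma adapted_factors:
  assumes "adapted k F"
  shows "F X = F (\<lambda>i. path_prefix k X ! i)"
proof -
  have "\<forall>i\<le>k. X i = path_prefix k X ! i" by (simp add: path_prefix_nth)
  then show ?thesis using assms unfolding adapted_def by blast
qed

lemma adapted_measurable:
  fixes F :: "(nat \<Rightarrow> 'a::countable) \<Rightarrow> ennreal"
  assumes "adapted k F" "sets N = sets path_space"
  shows "F \<in> borel_measurable N"
proof -
  have "path_prefix k \<in> N \<rightarrow>\<^sub>M count_space UNIV"
    by (subst measurable_cong_sets[OF assms(2) refl]) (rule path_prefix_measurable)
  then have "(\<lambda>X. (\<lambda>l. F (\<lambda>i. l ! i)) (path_prefix k X)) \<in> borel_measurable N"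
    by (rule measurable_compose) simp
  moreover have "F = (\<lambda>X. (\<lambda>l. F (\<lambda>i. l ! i)) (path_prefix k X))"
    by (intro ext) (rule adapted_factors[OF assms(1)])
  ultimately show ?thesis by (rule ssubst[rotated])
qed

context recurrent_chain
begin

lemma space_P [simp]: "space (P x) = UNIV"
proof -
  have "space (P x) = space path_space" by (rule sets_eq_imp_space_eq) (rule sets_P)
  then show ?thesis by (simp add: path_space_def space_PiM)
qed

lemma coordinate_measurable [measurable]: "(\<lambda>X. X k) \<in> P x \<rightarrow>\<^sub>M count_space UNIV"
  using sets_P by (rule path_coordinate_measurable)

lemma coordinate_event [measurable]: "{X. X k \<in> A} \<in> sets (P x)"
  using measurable_sets[OF coordinate_measurable[of k x], of A] by (simp add: vimage_def)

lemma prefix_measurable [measurable]: "path_prefix k \<in> P x \<rightarrow>\<^sub>M count_space UNIV"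
  by (subst measurable_cong_sets[OF sets_P refl]) (rule path_prefix_measurable)

lemma emeasure_prefix:
  assumes "length l = Suc k"
  shows "emeasure (P x) {X. path_prefix k X = l}
    = ennreal (if l ! 0 = x then \<Prod>i<k. p (l ! i) (l ! Suc i) else 0)"
proof -
  interpret prob_space "P x" by (rule prob_space_P)
  have "{X. path_prefix k X = l} = {X \<in> space (P x). \<forall>i\<le>k. X i = l ! i}"
    using assms by (simp add: path_prefix_eq_iff)
  then show ?thesis using cylinder[of x k "\<lambda>i. l ! i"] by (simp add: emeasure_eq_measure)
qed

lemma nn_integral_transition:
  assumes "\<And>y. 0 \<le> g y"
  shows "(\<integral>\<^sup>+y. ennreal (g y) * ennreal (p z y) \<partial>count_space UNIV) = ennreal (transition_op p g z)"
proof -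
  have nonneg: "0 \<le> p z y" for y using p_range[of z y] by simp
  have "(\<integral>\<^sup>+y. ennreal (g y) * ennreal (p z y) \<partial>count_space UNIV)
      = (\<Sum>y | p z y \<noteq> 0. ennreal (g y) * ennreal (p z y))"
    by (rule nn_integral_count_space') (auto intro: finite_range)
  also have "\<dots> = (\<Sum>y | p z y \<noteq> 0. ennreal (p z y * g y))"
    using assms nonneg by (intro sum.cong refl) (simp add: ennreal_mult mult.commute)
  also have "\<dots> = ennreal (transition_op p g z)"
    unfolding transition_op_def using assms nonneg by (intro sum_ennreal) simp
  finally show ?thesis .
qed

text \<open>
The Markov property on a single history \<open>l\<close>, where it is the cylinder formula for \<open>l\<close> and its
one-step extensions. Lists of the wrong length are harmless, as no path has them as prefix.
\<close>

lemma markov_on_cylinder: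
  assumes g: "\<And>y. 0 \<le> g y"
  shows "(\<integral>\<^sup>+X. ennreal (g (X (Suc k))) * indicator {l} (path_prefix k X) \<partial>P x)
       = (\<integral>\<^sup>+X. ennreal (transition_op p g (X k)) * indicator {l} (path_prefix k X) \<partial>P x)"
proof (cases "length l = Suc k")
  case True
  define c where "c = (if l ! 0 = x then \<Prod>i<k. p (l ! i) (l ! Suc i) else 0)"
  have c_nonneg: "0 \<le> c" unfolding c_def using p_range by (auto intro!: prod_nonneg)
  let ?A = "{X. path_prefix k X = l}"
  let ?B = "\<lambda>y. {X. path_prefix k X = l \<and> X (Suc k) = y}"
  have "{X \<in> space (P x). path_prefix k X = l} \<in> sets (P x)" by measurable
  then have [measurable]: "?A \<in> sets (P x)" by simp
  have "{X \<in> space (P x). path_prefix k X = l \<and> X (Suc k) = y} \<in> sets (P x)" for y by measurable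
  then have [measurable]: "?B y \<in> sets (P x)" for y by simp
  have prob: "emeasure (P x) (?B y) = ennreal c * ennreal (p (l ! k) y)" for y
  proof -
    have "?B y = {X. path_prefix (Suc k) X = l @ [y]}"
      by (auto simp: path_prefix_Suc)
    moreover have "(\<Prod>i<k. p ((l @ [y]) ! i) ((l @ [y]) ! Suc i)) = (\<Prod>i<k. p (l ! i) (l ! Suc i))"
      using True by (intro prod.cong refl) (simp add: nth_append)
    moreover have "(l @ [y]) ! 0 = l ! 0" "(l @ [y]) ! k = l ! k" "(l @ [y]) ! Suc k = y"
      using True by (simp_all add: nth_append)
    ultimately have "emeasure (P x) (?B y) = ennreal (c * p (l ! k) y)"
      using emeasure_prefix[of "l @ [y]" "Suc k" x] True by (simp add: c_def del: nth_append_length)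
    then show ?thesis using c_nonneg p_range[of "l ! k" y] by (simp add: ennreal_mult)
  qed
  have "(\<integral>\<^sup>+X. ennreal (g (X (Suc k))) * indicator {l} (path_prefix k X) \<partial>P x)
      = (\<integral>\<^sup>+y. \<integral>\<^sup>+X. ennreal (g (X (Suc k))) * indicator {l} (path_prefix k X)
                      * indicator {y} (X (Suc k)) \<partial>P x \<partial>count_space UNIV)"
    by (rule nn_integral_partition_countable) measurable
  also have "\<dots> = (\<integral>\<^sup>+y. \<integral>\<^sup>+X. ennreal (g y) * indicator (?B y) X \<partial>P x \<partial>count_space UNIV)"
    by (intro nn_integral_cong) (auto simp: indicator_def)
  also have "\<dots> = (\<integral>\<^sup>+y. ennreal c * (ennreal (g y) * ennreal (p (l ! k) y)) \<partial>count_space UNIV)"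
    by (simp add: nn_integral_cmult prob mult_ac)
  also have "\<dots> = ennreal c * ennreal (transition_op p g (l ! k))"
    by (simp add: nn_integral_cmult nn_integral_transition g)
  also have "\<dots> = (\<integral>\<^sup>+X. ennreal (transition_op p g (l ! k)) * indicator ?A X \<partial>P x)"
    using emeasure_prefix[OF True, of x] by (simp add: nn_integral_cmult c_def mult_ac)
  also have "\<dots> = (\<integral>\<^sup>+X. ennreal (transition_op p g (X k)) * indicator {l} (path_prefix k X) \<partial>P x)"
    by (intro nn_integral_cong) (auto simp: indicator_def path_prefix_nth)
  finally show ?thesis .
next
  case False
  then have "indicator {l} (path_prefix k X) = (0 :: ennreal)" for X
    by (auto simp: indicator_def)
  then show ?thesis by simp
qed

text \<open>
The case of one history is summed over all histories, of which there are countably many.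
\<close>

lemma markov_step:
  assumes F: "adapted k F" and g: "\<And>y. 0 \<le> g y"
  shows "(\<integral>\<^sup>+X. F X * ennreal (g (X (Suc k))) \<partial>P x) = (\<integral>\<^sup>+X. F X * ennreal (transition_op p g (X k)) \<partial>P x)"
proof -
  have [measurable]: "F \<in> borel_measurable (P x)" using F sets_P by (rule adapted_measurable)
  have split: "(\<integral>\<^sup>+X. F X * f X \<partial>P x) = (\<integral>\<^sup>+l. F (\<lambda>i. l ! i) *
      (\<integral>\<^sup>+X. f X * indicator {l} (path_prefix k X) \<partial>P x) \<partial>count_space UNIV)"
    if [measurable]: "f \<in> borel_measurable (P x)" for f
  proof -
    have "(\<integral>\<^sup>+X. F X * f X \<partial>P x)
        = (\<integral>\<^sup>+l. \<integral>\<^sup>+X. F X * f X * indicator {l} (path_prefix k X) \<partial>P x \<partial>count_space UNIV)"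
      by (rule nn_integral_partition_countable) measurable
    also have "\<dots> = (\<integral>\<^sup>+l. \<integral>\<^sup>+X. F (\<lambda>i. l ! i) * (f X * indicator {l} (path_prefix k X)) \<partial>P x
                      \<partial>count_space UNIV)"
    proof (intro nn_integral_cong)
      fix l X
      show "F X * f X * indicator {l} (path_prefix k X)
          = F (\<lambda>i. l ! i) * (f X * indicator {l} (path_prefix k X))"
        using adapted_factors[OF F, of X] by (cases "path_prefix k X = l") (simp_all add: mult.assoc)
    qed
    finally show ?thesis by (simp add: nn_integral_cmult)
  qed
  have "(\<integral>\<^sup>+X. F X * ennreal (g (X (Suc k))) \<partial>P x) = (\<integral>\<^sup>+l. F (\<lambda>i. l ! i) *
      (\<integral>\<^sup>+X. ennreal (g (X (Suc k))) * indicator {l} (path_prefix k X) \<partial>P x) \<partial>count_space UNIV)"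
    by (rule split) measurable
  also have "\<dots> = (\<integral>\<^sup>+l. F (\<lambda>i. l ! i) * (\<integral>\<^sup>+X. ennreal (transition_op p g (X k))
      * indicator {l} (path_prefix k X) \<partial>P x) \<partial>count_space UNIV)"
    by (simp only: markov_on_cylinder[of g, OF g])
  also have "\<dots> = (\<integral>\<^sup>+X. F X * ennreal (transition_op p g (X k)) \<partial>P x)"
    by (rule split[symmetric]) measurable
  finally show ?thesis .
qed

lemma nn_integral_initial: "(\<integral>\<^sup>+X. ennreal (g (X 0)) \<partial>P x) = ennreal (g x)"
proof -
  interpret prob_space "P x" by (rule prob_space_P)
  have "AE X in P x. X 0 = x"
    using cylinder[of x 0 "\<lambda>_. x"] coordinate_event[of 0 "{x}" x]
    by (subst prob_Collect_eq_1[symmetric]) auto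
  then have "(\<integral>\<^sup>+X. ennreal (g (X 0)) \<partial>P x) = (\<integral>\<^sup>+X. ennreal (g x) \<partial>P x)"
    by (intro nn_integral_cong_AE) auto
  then show ?thesis using emeasure_space_1 by simp
qed

sublocale full: finite_range_kernel p
  using p_range finite_range by unfold_locales auto

lemma nn_integral_coordinate:
  assumes "\<And>y. 0 \<le> g y"
  shows "(\<integral>\<^sup>+X. ennreal (g (X n)) \<partial>P x) = ennreal ((full.T ^^ n) g x)"
  using assms
proof (induction n arbitrary: g)
  case (Suc n)
  have "(\<integral>\<^sup>+X. 1 * ennreal (g (X (Suc n))) \<partial>P x) = (\<integral>\<^sup>+X. 1 * ennreal (full.T g (X n)) \<partial>P x)"
    by (rule markov_step) (auto simp: adapted_def Suc.prems)
  also have "\<dots> = ennreal ((full.T ^^ n) (full.T g) x)"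
    by (simp add: Suc.IH full.T_nonneg Suc.prems)
  finally show ?case by (simp add: funpow_Suc_right del: funpow.simps)
qed (simp add: nn_integral_initial)

lemma step_positive: "\<exists>n. (full.T ^^ n) (indicator {y}) x > 0"
proof -
  interpret prob_space "P x" by (rule prob_space_P)
  obtain n where "\<P>(X in P x. X n = y) > 0" using irreducible by blast
  then have "0 < emeasure (P x) {X \<in> space (P x). X n = y}" by (simp add: emeasure_eq_measure)
  also have "\<dots> = (\<integral>\<^sup>+X. indicator {X. X n = y} X \<partial>P x)"
    using coordinate_event[of n "{y}" x] by simp
  also have "\<dots> = (\<integral>\<^sup>+X. ennreal (indicator {y} (X n)) \<partial>P x)"
    by (intro nn_integral_cong) (auto split: split_indicator)
  also have "\<dots> = ennreal ((full.T ^^ n) (indicator {y}) x)"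
    by (rule nn_integral_coordinate) simp
  finally show ?thesis by (auto simp: ennreal_less_zero_iff)
qed

end

section \<open>The chain killed at \<open>x0\<close>\<close>

definition killed :: "('a \<Rightarrow> 'a \<Rightarrow> real) \<Rightarrow> 'a \<Rightarrow> 'a \<Rightarrow> 'a \<Rightarrow> real" where
  "killed p x0 x y = p x y * of_bool (y \<noteq> x0)"

locale killed_chain = recurrent_chain p P
  for p :: "'a::countable \<Rightarrow> 'a \<Rightarrow> real" and P +
  fixes x0 :: 'a and \<beta> :: "'a \<Rightarrow> real"
  assumes stationary: "stationary_measure p \<beta>"
begin

sublocale killed: finite_range_kernel "killed p x0"
proof
  show "0 \<le> killed p x0 x y" for x y using p_range[of x y] by (simp add: killed_def)
  have "{y. killed p x0 x y \<noteq> 0} \<subseteq> {y. p x y \<noteq> 0}" for x by (auto simp: killed_def)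
  then show "finite {y. killed p x0 x y \<noteq> 0}" for x using finite_range finite_subset by blast
qed

lemma killed_T_eq: "killed.T g x = (\<Sum>y | p x y \<noteq> 0. p x y * of_bool (y \<noteq> x0) * g y)"
  unfolding transition_op_def killed_def by (intro sum.mono_neutral_cong_left finite_range) auto

lemma killed_T_eq_full_T: "killed.T g x = full.T (\<lambda>y. of_bool (y \<noteq> x0) * g y) x"
  unfolding killed_T_eq by (simp add: transition_op_def mult_ac)

lemma full_T_split: "full.T g x = killed.T g x + p x x0 * g x0"
proof -
  have "full.T g x = (\<Sum>y | p x y \<noteq> 0. p x y * of_bool (y \<noteq> x0) * g y + of_bool (y = x0) * (p x y * g y))"
    unfolding transition_op_def by (intro sum.cong) auto
  also have "\<dots> = killed.T g x + (\<Sum>y | p x y \<noteq> 0. of_bool (y = x0) * (p x y * g y))"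
    by (simp add: sum.distrib killed_T_eq)
  also have "(\<Sum>y | p x y \<noteq> 0. of_bool (y = x0) * (p x y * g y)) = p x x0 * g x0"
    using finite_range[of x] by (simp add: of_bool_def if_distrib if_distribR sum.delta cong: if_cong)
  finally show ?thesis .
qed

lemma stationary_nonneg: "0 \<le> \<beta> y"
  using stationary by (simp add: stationary_measure_def)

text \<open>
Nonnegative functions \<open>g\<close> need not be summable against \<open>\<beta>\<close>, so the integral of \<open>g\<close> being at most \<open>c\<close> is
expressed by its finite partial sums. Stationarity then says that the bound is inherited by the image
of \<open>g\<close> under the transition operator.
\<close>

lemma stationary_excessive:
  assumes g: "\<And>y. 0 \<le> g y" and c: "\<And>S. finite S \<Longrightarrow> (\<Sum>y\<in>S. \<beta> y * g y) \<le> c" and S: "finite S"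
  shows "(\<Sum>x\<in>S. \<beta> x * full.T g x) \<le> c"
proof -
  define Y where "Y = (\<Union>x\<in>S. {y. p x y \<noteq> 0})"
  have Y: "finite Y" unfolding Y_def using S finite_range by blast
  have "full.T g x = (\<Sum>y\<in>Y. p x y * g y)" if "x \<in> S" for x
    unfolding transition_op_def using that Y by (intro sum.mono_neutral_left) (auto simp: Y_def)
  then have "(\<Sum>x\<in>S. \<beta> x * full.T g x) = (\<Sum>x\<in>S. \<Sum>y\<in>Y. g y * (p x y * \<beta> x))"
    by (simp add: sum_distrib_left mult_ac)
  also have "\<dots> = (\<Sum>y\<in>Y. g y * (\<Sum>x\<in>S. p x y * \<beta> x))"
    by (subst sum.swap) (simp add: sum_distrib_left)
  also have "\<dots> \<le> (\<Sum>y\<in>Y. g y * \<beta> y)"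
  proof (intro sum_mono mult_left_mono g)
    fix y
    have "((\<lambda>x. p x y * \<beta> x) has_sum \<beta> y) UNIV"
      using stationary by (simp add: stationary_measure_def)
    then show "(\<Sum>x\<in>S. p x y * \<beta> x) \<le> \<beta> y"
      using S p_range stationary_nonneg by (intro finite_sum_le_has_sum) auto
  qed
  also have "\<dots> \<le> c" using c[OF Y] by (simp add: mult_ac)
  finally show ?thesis .
qed

lemma stationary_indicator_le:
  assumes "finite S"
  shows "(\<Sum>x\<in>S. \<beta> x * indicator {y} x) \<le> \<beta> y"
proof -
  have "(\<Sum>x\<in>S. \<beta> x * indicator {y} x) = (\<Sum>x\<in>S. if x = y then \<beta> y else 0)"
    by (intro sum.cong) auto
  also have "\<dots> = (if y \<in> S then \<beta> y else 0)" using assms by (rule sum.delta)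
  also have "\<dots> \<le> \<beta> y" using stationary_nonneg[of y] by simp
  finally show ?thesis .
qed

text \<open>
Some state \<open>x\<close> has positive mass, and a path from \<open>x\<close> to \<open>y\<close> transports part of it to \<open>y\<close>.
\<close>

lemma stationary_positive: "0 < \<beta> y"
proof -
  obtain x where "\<beta> x \<noteq> 0" using stationary by (auto simp: stationary_measure_def)
  then have x: "0 < \<beta> x" using stationary_nonneg[of x] by simp
  obtain n where n: "(full.T ^^ n) (indicator {y}) x > 0" using step_positive by blast
  have "finite S \<Longrightarrow> (\<Sum>x\<in>S. \<beta> x * (full.T ^^ n) (indicator {y}) x) \<le> \<beta> y" for S
  proof (induction n arbitrary: S)
    case 0
    then show ?case using stationary_indicator_le[of S y] by simp
  next
    case (Suc n)
    show ?case unfolding funpow.simps comp_apply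
      by (rule stationary_excessive[OF _ Suc.IH Suc.prems]) (auto intro: full.iterate_nonneg)
  qed
  from this[of "{x}"] have "\<beta> x * (full.T ^^ n) (indicator {y}) x \<le> \<beta> y" by simp
  with x n show ?thesis by (meson mult_pos_pos less_le_trans)
qed

text \<open>
The occupation measure of an excursion from \<open>x0\<close>, multiplied by \<open>\<beta> x0\<close>, is dominated by \<open>\<beta>\<close>: at
every step the mass that sits at \<open>x0\<close> is split off, and the rest moves on under the killed kernel.
\<close>

lemma excursion_occupation_bound:
  assumes g: "\<And>y. 0 \<le> g y" and c: "\<And>S. finite S \<Longrightarrow> (\<Sum>y\<in>S. \<beta> y * g y) \<le> c"
  shows "\<beta> x0 * (\<Sum>k<n. (killed.T ^^ k) g x0) \<le> c"
proof -
  have "finite S \<Longrightarrow>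
    \<beta> x0 * (\<Sum>k<n. (killed.T ^^ k) g x0) + (\<Sum>x\<in>S. \<beta> x * (killed.T ^^ n) g x) \<le> c" for S
  proof (induction n arbitrary: S)
    case (Suc n)
    define u where "u = (killed.T ^^ n) g"
    define c' where "c' = c - \<beta> x0 * (\<Sum>k<n. (killed.T ^^ k) g x0) - \<beta> x0 * u x0"
    have u: "0 \<le> u y" for y unfolding u_def using g by (rule killed.iterate_nonneg)
    have "(\<Sum>y\<in>S'. \<beta> y * (of_bool (y \<noteq> x0) * u y)) \<le> c'" if S': "finite S'" for S'
    proof -
      have "(\<Sum>y\<in>S'. \<beta> y * (of_bool (y \<noteq> x0) * u y)) = (\<Sum>y\<in>S' - {x0}. \<beta> y * u y)"
        using S' by (intro sum.mono_neutral_cong_right) auto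
      moreover have "(\<Sum>y\<in>insert x0 (S' - {x0}). \<beta> y * u y) = \<beta> x0 * u x0 + (\<Sum>y\<in>S' - {x0}. \<beta> y * u y)"
        using S' by (subst sum.insert) auto
      moreover have "\<beta> x0 * (\<Sum>k<n. (killed.T ^^ k) g x0) + (\<Sum>y\<in>insert x0 (S' - {x0}). \<beta> y * u y) \<le> c"
        unfolding u_def using S' by (intro Suc.IH) auto
      ultimately show ?thesis by (simp add: c'_def)
    qed
    then have "(\<Sum>x\<in>S. \<beta> x * full.T (\<lambda>y. of_bool (y \<noteq> x0) * u y) x) \<le> c'"
      using u Suc.prems by (intro stationary_excessive) auto
    then have "(\<Sum>x\<in>S. \<beta> x * killed.T u x) \<le> c'"
      by (simp only: killed_T_eq_full_T)
    then show ?case by (simp add: u_def c'_def algebra_simps)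
  qed (use c in simp)
  from this[of "{}"] show ?thesis by simp
qed

text \<open>
At the least time \<open>n\<close> at which the full chain can go from \<open>x0\<close> to \<open>y\<close>, no path of length \<open>n\<close> from \<open>x0\<close>
to \<open>y\<close> returns to \<open>x0\<close> in between, for otherwise its last piece would be shorter.
\<close>

lemma killed_reaches: "\<exists>n. (killed.T ^^ n) (indicator {y}) x0 > 0"
proof -
  define g :: "'a \<Rightarrow> real" where "g = indicator {y}"
  define n where "n = (LEAST n. (full.T ^^ n) g x0 > 0)"
  have n: "(full.T ^^ n) g x0 > 0"
    unfolding n_def using step_positive[of y x0] by (auto simp: g_def intro: LeastI_ex)
  have before: "(full.T ^^ j) g x0 = 0" if "j < n" for j
    using not_less_Least[of j "\<lambda>n. (full.T ^^ n) g x0 > 0"] that full.iterate_nonneg[of g j x0]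
    by (auto simp: n_def g_def not_less intro: antisym)
  have "j \<le> n \<Longrightarrow> (full.T ^^ j) g = (killed.T ^^ j) g" for j
  proof (induction j)
    case (Suc j)
    then have "full.T ((full.T ^^ j) g) x = killed.T ((full.T ^^ j) g) x" for x
      using before[of j] by (simp add: full_T_split)
    then show ?case using Suc by (metis Suc_leD comp_apply ext funpow.simps(2))
  qed simp
  with n show ?thesis unfolding g_def by (metis order_refl)
qed

text \<open>
A path from \<open>x0\<close> to \<open>v\<close> that does not return to \<open>x0\<close>, of length \<open>j\<close> and with positive weight \<open>q\<close>, can be
put in front of every path from \<open>v\<close>. This bounds quantities started at \<open>v\<close> by those started at \<open>x0\<close>.
\<close>

lemma killed_iterate_comparison:
  "\<exists>q>0. \<exists>j. \<forall>k y. q * (killed.T ^^ k) (indicator {y}) v \<le> (killed.T ^^ (k + j)) (indicator {y}) x0"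
proof -
  obtain j where j: "(killed.T ^^ j) (indicator {v}) x0 > 0" using killed_reaches by blast
  have "(killed.T ^^ j) (indicator {v}) x0 * (killed.T ^^ k) (indicator {y}) v
      \<le> (killed.T ^^ (k + j)) (indicator {y}) x0" for k y
  proof -
    let ?u = "(killed.T ^^ k) (indicator {y})"
    have "?u v * (killed.T ^^ j) (indicator {v}) x0 = (killed.T ^^ j) (\<lambda>x. ?u v * indicator {v} x) x0"
      by (simp add: killed.iterate_cmult)
    also have "\<dots> \<le> (killed.T ^^ j) ?u x0"
      by (intro killed.iterate_mono) (auto simp: indicator_def intro!: killed.iterate_nonneg)
    also have "\<dots> = (killed.T ^^ (k + j)) (indicator {y}) x0"
      by (subst add.commute) (simp add: funpow_add)
    finally show ?thesis by (simp add: mult.commute)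
  qed
  with j show ?thesis by blast
qed

lemma killed_summable_x0: "summable (\<lambda>k. (killed.T ^^ k) (indicator {y}) x0)"
proof (rule bounded_imp_summable)
  show "0 \<le> (killed.T ^^ k) (indicator {y}) x0" for k by (rule killed.iterate_nonneg) simp
  show "(\<Sum>k\<le>n. (killed.T ^^ k) (indicator {y}) x0) \<le> \<beta> y / \<beta> x0" for n
  proof -
    have "\<beta> x0 * (\<Sum>k<Suc n. (killed.T ^^ k) (indicator {y}) x0) \<le> \<beta> y"
      by (intro excursion_occupation_bound stationary_indicator_le) auto
    then show ?thesis
      using stationary_positive[of x0]
      by (simp add: pos_le_divide_eq mult.commute lessThan_Suc_atMost del: sum.lessThan_Suc)
  qed
qed

sublocale killed: transient_kernel "killed p x0"
proof
  fix x y
  obtain q j where q: "q > 0"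
    "\<And>k y. q * (killed.T ^^ k) (indicator {y}) x \<le> (killed.T ^^ (k + j)) (indicator {y}) x0"
    using killed_iterate_comparison[of x] by blast
  have nonneg: "0 \<le> (killed.T ^^ k) (indicator {y}) x" for k by (rule killed.iterate_nonneg) simp
  have "summable (\<lambda>k. q * (killed.T ^^ k) (indicator {y}) x)"
  proof (rule summable_comparison_test')
    show "summable (\<lambda>k. (killed.T ^^ (k + j)) (indicator {y}) x0)"
      using killed_summable_x0 by (rule summable_ignore_initial_segment)
    show "norm (q * (killed.T ^^ k) (indicator {y}) x) \<le> (killed.T ^^ (k + j)) (indicator {y}) x0"
      if "k \<ge> 0" for k
      using q nonneg by simp
  qed
  then show "summable (\<lambda>k. (killed.T ^^ k) (indicator {y}) x)"
    using q(1) by (simp add: summable_cmult_iff)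
qed

lemma G_x0_positive: "0 < killed.G x0 y"
proof -
  obtain n where "(killed.T ^^ n) (indicator {y}) x0 > 0" using killed_reaches by blast
  also have "(killed.T ^^ n) (indicator {y}) x0 \<le> (\<Sum>k<Suc n. (killed.T ^^ k) (indicator {y}) x0)"
    using sum_nonneg[of "{..<n}" "\<lambda>k. (killed.T ^^ k) (indicator {y}) x0"]
    by (simp add: killed.iterate_indicator_nonneg)
  also have "\<dots> \<le> killed.G x0 y" by (rule killed.partial_sum_le_G)
  finally show ?thesis .
qed

lemma G_le_G_x0: "\<exists>q>0. \<forall>y. q * killed.G v y \<le> killed.G x0 y"
proof -
  obtain q j where q: "q > 0"
    "\<And>k y. q * (killed.T ^^ k) (indicator {y}) v \<le> (killed.T ^^ (k + j)) (indicator {y}) x0"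
    using killed_iterate_comparison[of v] by blast
  have "q * killed.G v y \<le> killed.G x0 y" for y
  proof -
    have "q * killed.G v y = (\<Sum>k. q * (killed.T ^^ k) (indicator {y}) v)"
      unfolding killed.G_def by (rule suminf_mult[symmetric]) (rule killed.green_summable)
    also have "\<dots> \<le> (\<Sum>k. (killed.T ^^ (k + j)) (indicator {y}) x0)"
    proof (rule suminf_le)
      show "summable (\<lambda>k. q * (killed.T ^^ k) (indicator {y}) v)"
        by (intro summable_mult killed.green_summable)
      show "summable (\<lambda>k. (killed.T ^^ (k + j)) (indicator {y}) x0)"
        by (rule summable_ignore_initial_segment) (rule killed.green_summable)
    qed (rule q(2))
    also have "\<dots> \<le> killed.G x0 y"
      using suminf_split_initial_segment[OF killed.green_summable, of y x0 j]
      by (simp add: killed.G_def sum_nonneg killed.iterate_indicator_nonneg)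
    finally show ?thesis .
  qed
  with q(1) show ?thesis by blast
qed

lemma le_return_time_iff:
  "enat k \<le> return_time x0 X - 1 \<longleftrightarrow> (\<forall>j. 1 \<le> j \<and> j \<le> k \<longrightarrow> X j \<noteq> x0)"
proof -
  have iff: "enat m \<le> return_time x0 X \<longleftrightarrow> (\<forall>j. 1 \<le> j \<and> X j = x0 \<longrightarrow> m \<le> j)" for m
    by (auto simp: return_time_def le_INF_iff)
  have "enat 1 \<le> return_time x0 X" by (subst iff) simp
  then have "enat k \<le> return_time x0 X - 1 \<longleftrightarrow> enat (Suc k) \<le> return_time x0 X"
    by (cases "return_time x0 X") (auto simp: one_enat_def)
  then show ?thesis unfolding iff by (auto simp: not_less_eq_eq[symmetric])
qed

lemma nn_integral_before_return:
  assumes "\<And>y. 0 \<le> g y"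
  shows "(\<integral>\<^sup>+X. of_bool (\<forall>j. 1 \<le> j \<and> j \<le> k \<longrightarrow> X j \<noteq> x0) * ennreal (g (X k)) \<partial>P x)
       = ennreal ((killed.T ^^ k) g x)"
  using assms
proof (induction k arbitrary: g)
  case 0
  show ?case by (auto simp: nn_integral_initial)
next
  case (Suc k)
  let ?F = "\<lambda>X. of_bool (\<forall>j. 1 \<le> j \<and> j \<le> k \<longrightarrow> X j \<noteq> x0) :: ennreal"
  have "(\<integral>\<^sup>+X. of_bool (\<forall>j. 1 \<le> j \<and> j \<le> Suc k \<longrightarrow> X j \<noteq> x0) * ennreal (g (X (Suc k))) \<partial>P x)
      = (\<integral>\<^sup>+X. ?F X * ennreal (of_bool (X (Suc k) \<noteq> x0) * g (X (Suc k))) \<partial>P x)"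
    by (intro nn_integral_cong) (auto simp: le_Suc_eq)
  also have "\<dots> = (\<integral>\<^sup>+X. ?F X * ennreal (full.T (\<lambda>y. of_bool (y \<noteq> x0) * g y) (X k)) \<partial>P x)"
    by (rule markov_step) (auto simp: adapted_def Suc.prems)
  also have "\<dots> = (\<integral>\<^sup>+X. ?F X * ennreal (killed.T g (X k)) \<partial>P x)"
    by (simp add: killed_T_eq_full_T)
  also have "\<dots> = ennreal ((killed.T ^^ k) (killed.T g) x)"
    by (rule Suc.IH) (rule killed.T_nonneg, rule Suc.prems)
  finally show ?case by (simp add: funpow_Suc_right del: funpow.simps)
qed

text \<open>
The expected local time before the return to \<open>x0\<close> is summed over the time of the visit; each term is
the probability that the killed chain is in \<open>y\<close> at that time.
\<close>

lemma green_eq_G: "green P x0 x y = killed.G x y"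
proof -
  let ?F = "\<lambda>k X. of_bool (\<forall>j. 1 \<le> j \<and> j \<le> k \<longrightarrow> X j \<noteq> x0) * ennreal (indicator {y} (X k))"
  have "(\<integral>\<^sup>+X. local_time y (return_time x0 X - 1) X \<partial>P x) = (\<integral>\<^sup>+X. (\<Sum>k. ?F k X) \<partial>P x)"
    unfolding local_time_def le_return_time_iff
    by (intro nn_integral_cong suminf_cong) (auto simp: indicator_def)
  also have "\<dots> = (\<Sum>k. \<integral>\<^sup>+X. ?F k X \<partial>P x)"
    by (intro nn_integral_suminf adapted_measurable[OF _ sets_P]) (auto simp: adapted_def)
  also have "\<dots> = (\<Sum>k. ennreal ((killed.T ^^ k) (indicator {y}) x))"
    by (subst nn_integral_before_return) auto
  also have "\<dots> = ennreal (killed.G x y)"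
    unfolding killed.G_def
    by (intro suminf_ennreal2 killed.iterate_indicator_nonneg killed.green_summable)
  finally show ?thesis unfolding green_def by (simp add: killed.G_nonneg)
qed

end

section \<open>The Martin kernel and the completion\<close>

context killed_chain
begin

lemma martin_kernel_eq: "martin_kernel P x0 v y = killed.G v y / killed.G x0 y"
  by (simp add: martin_kernel_def green_eq_G)

lemma martin_kernel_mult: "martin_kernel P x0 v y * killed.G x0 y = killed.G v y"
  using G_x0_positive[of y] by (simp add: martin_kernel_eq)

lemma martin_kernel_nonneg: "0 \<le> martin_kernel P x0 v y"
  by (simp add: martin_kernel_eq killed.G_nonneg)

lemma martin_kernel_x0: "martin_kernel P x0 x0 y = 1"
  using G_x0_positive[of y] by (simp add: martin_kernel_eq)

lemma bdd_above_martin_kernel: "bdd_above (range (martin_kernel P x0 v))"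
proof -
  obtain q where "q > 0" "\<And>y. q * killed.G v y \<le> killed.G x0 y" using G_le_G_x0 by blast
  then have "martin_kernel P x0 v y \<le> 1 / q" for y
    using G_x0_positive[of y] by (simp add: martin_kernel_eq field_simps)
  then show ?thesis by (auto simp: bdd_above_def)
qed

end

locale martin_completion = killed_chain +
  fixes w :: "'a::countable \<Rightarrow> real" and M :: "'b metric" and \<iota> :: "'a \<Rightarrow> 'b"
  assumes w_positive: "w z > 0"
    and w_summable: "w summable_on UNIV"
    and completion: "is_completion (martin_dist P x0 w) M \<iota>"
begin

abbreviation K :: "'a \<Rightarrow> 'a \<Rightarrow> real" where "K \<equiv> martin_kernel P x0"

abbreviation D :: "'a \<Rightarrow> real" where "D z \<equiv> SUP u. K z u"

abbreviation h :: "'b \<Rightarrow> 'a \<Rightarrow> real" where "h \<alpha> z \<equiv> martin_kernel_ext P x0 M \<iota> z \<alpha>"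

definition dist_term :: "'a \<Rightarrow> 'a \<Rightarrow> 'a \<Rightarrow> real" where
  "dist_term x y z = w z * (\<bar>K z x - K z y\<bar> + \<bar>of_bool (z = x) - of_bool (z = y)\<bar>) / (D z + 1)"

lemma K_le_D: "K z y \<le> D z"
  by (rule cSUP_upper) (auto intro: bdd_above_martin_kernel)

lemma D_nonneg: "0 \<le> D z"
  using martin_kernel_nonneg K_le_D by (rule order_trans)

lemma dist_term_nonneg: "0 \<le> dist_term x y z"
  unfolding dist_term_def using w_positive[of z] D_nonneg[of z]
  by (intro divide_nonneg_nonneg mult_nonneg_nonneg) auto

text \<open>
This is why the Martin distance is normalized by \<open>D z + 1\<close>.
\<close>

lemma dist_term_le: "dist_term x y z \<le> w z"
proof -
  have "\<bar>K z x - K z y\<bar> \<le> D z"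
    using K_le_D[of z x] K_le_D[of z y] martin_kernel_nonneg[of z x] martin_kernel_nonneg[of z y] by linarith
  moreover have "\<bar>of_bool (z = x) - of_bool (z = y)\<bar> \<le> (1 :: real)" by auto
  ultimately have "\<bar>K z x - K z y\<bar> + \<bar>of_bool (z = x) - of_bool (z = y)\<bar> \<le> D z + 1" by linarith
  then have "w z * (\<bar>K z x - K z y\<bar> + \<bar>of_bool (z = x) - of_bool (z = y)\<bar>) \<le> w z * (D z + 1)"
    using w_positive[of z] by (intro mult_left_mono) auto
  then show ?thesis unfolding dist_term_def using D_nonneg[of z] by (simp add: pos_divide_le_eq)
qed

lemma dist_term_summable: "dist_term x y summable_on A"
proof (rule summable_on_comparison_test)
  show "w summable_on A" using w_summable by (rule summable_on_subset_banach) auto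
qed (auto intro: dist_term_nonneg dist_term_le)

lemma mdist_embedded: "mdist M (\<iota> x) (\<iota> y) = (\<Sum>\<^sub>\<infinity>z. dist_term x y z)"
  using completion by (simp add: is_completion_def martin_dist_def dist_term_def)

lemma embedded_in_space [simp]: "\<iota> y \<in> mspace M"
  using completion by (auto simp: is_completion_def)

lemma K_lipschitz: "\<bar>K z x - K z y\<bar> \<le> (D z + 1) / w z * mdist M (\<iota> x) (\<iota> y)"
proof -
  have "w z * \<bar>K z x - K z y\<bar> / (D z + 1) \<le> dist_term x y z"
    unfolding dist_term_def using w_positive[of z] D_nonneg[of z]
    by (intro divide_right_mono mult_left_mono) auto
  also have "\<dots> \<le> mdist M (\<iota> x) (\<iota> y)"
    using finite_sum_le_infsum[OF dist_term_summable[of x y UNIV], of "{z}"]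
    by (simp add: mdist_embedded dist_term_nonneg)
  finally show ?thesis using w_positive[of z] D_nonneg[of z] by (simp add: field_simps)
qed

lemma embedded_dense:
  assumes "\<alpha> \<in> mspace M" "r > 0"
  shows "\<exists>y. mdist M (\<iota> y) \<alpha> < r"
proof -
  interpret Metric_space "mspace M" "mdist M" by simp
  have "\<alpha> \<in> mtopology closure_of range \<iota>"
    using completion assms(1) by (simp add: is_completion_def mtopology_of_def)
  then obtain y where "\<iota> y \<in> mball \<alpha> r" using assms(2) by (auto simp: metric_closure_of)
  then show ?thesis by (auto simp: mdist_commute)
qed

text \<open>
Each \<open>K z\<close> is Lipschitz for the Martin distance, hence extends continuously to the completion, and the
estimate persists with the extended value. In particular the limit defining the extension exists.
\<close>

lemma kernel_ext_lipschitz: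
  assumes \<alpha>: "\<alpha> \<in> mspace M"
  shows "\<bar>K z y - h \<alpha> z\<bar> \<le> (D z + 1) / w z * mdist M (\<iota> y) \<alpha>"
proof -
  define c where "c = (D z + 1) / w z"
  have c: "c > 0" unfolding c_def using w_positive[of z] D_nonneg[of z] by (simp add: add_nonneg_pos)
  have self: "mdist M \<alpha> \<alpha> = 0" using \<alpha> by simp
  have "\<exists>y. mdist M (\<iota> y) \<alpha> < inverse (real (Suc n))" for n
    using \<alpha> by (intro embedded_dense) auto
  then obtain a where a: "\<And>n. mdist M (\<iota> (a n)) \<alpha> < inverse (real (Suc n))" by metis
  have a_lim: "(\<lambda>n. mdist M (\<iota> (a n)) \<alpha>) \<longlonglongrightarrow> 0"
    by (rule tendsto_sandwich[OF _ _ tendsto_const LIMSEQ_inverse_real_of_nat])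
      (auto intro!: always_eventually less_imp_le[OF a] simp del: of_nat_Suc)
  have near: "\<bar>K z y - K z (a n)\<bar> \<le> c * (mdist M (\<iota> y) \<alpha> + mdist M (\<iota> (a n)) \<alpha>)" for y n
  proof -
    have "\<bar>K z y - K z (a n)\<bar> \<le> c * mdist M (\<iota> y) (\<iota> (a n))"
      unfolding c_def by (rule K_lipschitz)
    also have "\<dots> \<le> c * (mdist M (\<iota> y) \<alpha> + mdist M \<alpha> (\<iota> (a n)))"
      using c \<alpha> by (intro mult_left_mono mdist_triangle) auto
    finally show ?thesis by (simp add: mdist_commute)
  qed
  have "Cauchy (\<lambda>n. K z (a n))"
  proof (rule metric_CauchyI)
    fix e :: real assume e: "e > 0"
    have "\<forall>\<^sub>F n in sequentially. mdist M (\<iota> (a n)) \<alpha> < e / (2 * c)"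
      using a_lim e c by (intro order_tendstoD) auto
    then obtain N where N: "\<And>n. n \<ge> N \<Longrightarrow> mdist M (\<iota> (a n)) \<alpha> < e / (2 * c)"
      by (auto simp: eventually_sequentially)
    have "dist (K z (a m)) (K z (a n)) < e" if "m \<ge> N" "n \<ge> N" for m n
    proof -
      have "\<bar>K z (a m) - K z (a n)\<bar> \<le> c * (mdist M (\<iota> (a m)) \<alpha> + mdist M (\<iota> (a n)) \<alpha>)" by (rule near)
      also have "\<dots> < c * (e / (2 * c) + e / (2 * c))"
        using N[OF that(1)] N[OF that(2)] c by (intro mult_strict_left_mono add_strict_mono) auto
      also have "\<dots> = e" using c by simp
      finally show ?thesis by (simp add: dist_real_def)
    qed
    then show "\<exists>N. \<forall>m\<ge>N. \<forall>n\<ge>N. dist (K z (a m)) (K z (a n)) < e" by blast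
  qed
  then obtain l where l: "(\<lambda>n. K z (a n)) \<longlonglongrightarrow> l" by (auto simp: Cauchy_convergent_iff convergent_def)
  have lip: "\<bar>K z y - l\<bar> \<le> c * mdist M (\<iota> y) \<alpha>" for y
  proof (rule LIMSEQ_le)
    show "(\<lambda>n. \<bar>K z y - K z (a n)\<bar>) \<longlonglongrightarrow> \<bar>K z y - l\<bar>" by (intro tendsto_intros l)
    show "(\<lambda>n. c * (mdist M (\<iota> y) \<alpha> + mdist M (\<iota> (a n)) \<alpha>)) \<longlonglongrightarrow> c * mdist M (\<iota> y) \<alpha>"
      using a_lim by (auto intro!: tendsto_eq_intros)
  qed (use near in auto)
  have "h \<alpha> z = l"
    unfolding martin_kernel_ext_def
  proof (rule tendsto_Lim)
    show "filtercomap \<iota> (nhdsin (mtopology_of M) \<alpha>) \<noteq> bot"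
    proof (rule filtercomap_neq_bot)
      fix R assume "eventually R (nhdsin (mtopology_of M) \<alpha>)"
      then obtain S where S: "openin (mtopology_of M) S" "\<alpha> \<in> S" "\<And>u. u \<in> S \<Longrightarrow> R u"
        using \<alpha> by (auto simp: eventually_nhdsin)
      have "\<alpha> \<in> mtopology_of M closure_of range \<iota>" using completion \<alpha> by (simp add: is_completion_def)
      with S show "\<exists>x. R (\<iota> x)" unfolding in_closure_of by blast
    qed
    show "(K z \<longlongrightarrow> l) (filtercomap \<iota> (nhdsin (mtopology_of M) \<alpha>))"
    proof (rule tendstoI)
      fix e :: real assume e: "e > 0"
      have "openin (mtopology_of M) (mball_of M \<alpha> (e / c))"
        by (simp add: mtopology_of_def mball_of_def Metric_space.openin_mball)
      then have "\<forall>\<^sub>F u in nhdsin (mtopology_of M) \<alpha>. mdist M u \<alpha> < e / c"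
        unfolding eventually_nhdsin using \<alpha> e c
        by (intro disjI2 exI[of _ "mball_of M \<alpha> (e / c)"]) (auto simp: mdist_commute self)
      then have "\<forall>\<^sub>F y in filtercomap \<iota> (nhdsin (mtopology_of M) \<alpha>). mdist M (\<iota> y) \<alpha> < e / c"
        by (rule eventually_filtercomapI)
      then show "\<forall>\<^sub>F y in filtercomap \<iota> (nhdsin (mtopology_of M) \<alpha>). dist (K z y) l < e"
      proof eventually_elim
        case (elim y)
        then have "c * mdist M (\<iota> y) \<alpha> < e" using c by (simp add: field_simps)
        then show ?case using lip[of y] by (simp add: dist_real_def)
      qed
    qed
  qed
  then show ?thesis using lip by (simp add: c_def)
qed

lemma kernel_ext_nonneg:
  assumes "\<alpha> \<in> mspace M"
  shows "0 \<le> h \<alpha> z"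
proof (rule field_le_epsilon)
  fix e :: real assume e: "e > 0"
  define c where "c = (D z + 1) / w z"
  have c: "c > 0" unfolding c_def using w_positive[of z] D_nonneg[of z] by (simp add: add_nonneg_pos)
  obtain y where y: "mdist M (\<iota> y) \<alpha> < e / c"
    using embedded_dense[OF assms, of "e / c"] e c by auto
  have "c * mdist M (\<iota> y) \<alpha> < e" using y c by (simp add: field_simps)
  then show "0 \<le> h \<alpha> z + e"
    using kernel_ext_lipschitz[OF assms, of z y] martin_kernel_nonneg[of z y] by (simp add: c_def)
qed

lemma kernel_ext_x0:
  assumes "\<alpha> \<in> mspace M"
  shows "h \<alpha> x0 = 1"
proof (rule ccontr)
  assume "h \<alpha> x0 \<noteq> 1"
  define c where "c = (D x0 + 1) / w x0"
  have c: "c > 0" unfolding c_def using w_positive[of x0] D_nonneg[of x0] by (simp add: add_nonneg_pos)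
  obtain y where y: "mdist M (\<iota> y) \<alpha> < \<bar>1 - h \<alpha> x0\<bar> / c"
    using embedded_dense[OF assms, of "\<bar>1 - h \<alpha> x0\<bar> / c"] \<open>h \<alpha> x0 \<noteq> 1\<close> c by auto
  then have "c * mdist M (\<iota> y) \<alpha> < \<bar>1 - h \<alpha> x0\<bar>" using c by (simp add: field_simps)
  then show False
    using kernel_ext_lipschitz[OF assms, of x0 y] by (simp add: c_def martin_kernel_x0)
qed

text \<open>
Up to a small tail of \<open>w\<close>, the Martin distance involves only finitely many \<open>z \<in> F\<close>. As \<open>\<alpha>\<close> is not a
state, both the sequence and a state \<open>y\<close> close to \<open>\<alpha>\<close> lie outside \<open>F\<close>, so that the indicator terms for
\<open>z \<in> F\<close> vanish and only the differences of kernels remain.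
\<close>

lemma limitin_boundary_point:
  assumes \<alpha>: "\<alpha> \<in> martin_boundary M \<iota>"
    and lim: "\<And>z. (\<lambda>n. K z (a n)) \<longlonglongrightarrow> h \<alpha> z"
    and leaves: "\<And>y. \<forall>\<^sub>F n in sequentially. a n \<noteq> y"
  shows "limitin (mtopology_of M) (\<lambda>n. \<iota> (a n)) \<alpha> sequentially"
proof -
  have \<alpha>M: "\<alpha> \<in> mspace M" and away: "\<And>y. \<iota> y \<noteq> \<alpha>" using \<alpha> by (auto simp: martin_boundary_def)
  have "\<forall>\<^sub>F n in sequentially. mdist M (\<iota> (a n)) \<alpha> < e" if e: "e > 0" for e
  proof -
    have "(w has_sum infsum w UNIV) UNIV" using w_summable by (rule has_sum_infsum)
    then have "\<forall>\<^sub>F F in finite_subsets_at_top UNIV. dist (sum w F) (infsum w UNIV) < e / 3"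
      unfolding has_sum_def using e by (intro tendstoD) auto
    then obtain F where F: "finite F" "dist (sum w F) (infsum w UNIV) < e / 3"
      unfolding eventually_finite_subsets_at_top by blast
    have tail: "infsum w (- F) < e / 3"
    proof -
      have "infsum w UNIV = infsum w F + infsum w (- F)"
        using w_summable F(1)
        by (subst infsum_Un_disjoint[symmetric]) (auto intro: summable_on_subset_banach simp: Un_commute)
      then show ?thesis using F by (simp add: dist_real_def)
    qed
    \<comment> \<open>\<open>s\<close> bounds the differences of kernels on \<open>F\<close>; \<open>r\<close> says how close to \<open>\<alpha>\<close> the auxiliary state must be\<close>
    define s where "s = e / (3 * (sum w F + 1))"
    have wF: "0 \<le> sum w F" by (intro sum_nonneg less_imp_le w_positive)
    have s: "s > 0" unfolding s_def using e wF by simp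
    define r where "r = Min (insert (e / 3) ((\<lambda>z. mdist M (\<iota> z) \<alpha>) ` F \<union> (\<lambda>z. s / 2 * w z / (D z + 1)) ` F))"
    have "0 < mdist M (\<iota> z) \<alpha>" for z
      using away[of z] \<alpha>M mdist_zero[of "\<iota> z" M \<alpha>] mdist_nonneg[of M "\<iota> z" \<alpha>] by (simp add: less_le)
    moreover have "0 < s / 2 * w z / (D z + 1)" for z
      using s w_positive[of z] D_nonneg[of z] by (simp add: add_nonneg_pos)
    ultimately have "r > 0" unfolding r_def using F(1) e by (subst Min_gr_iff) auto
    have r_le: "r \<le> e / 3" "\<And>z. z \<in> F \<Longrightarrow> r \<le> mdist M (\<iota> z) \<alpha>"
        "\<And>z. z \<in> F \<Longrightarrow> r \<le> s / 2 * w z / (D z + 1)"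
      unfolding r_def by (rule Min_le, use F(1) in auto)+
    obtain y where y: "mdist M (\<iota> y) \<alpha> < r" using embedded_dense[OF \<alpha>M \<open>r > 0\<close>] by blast
    have "y \<notin> F" using r_le(2) y by fastforce
    have Ky: "\<bar>K z y - h \<alpha> z\<bar> < s / 2" if "z \<in> F" for z
    proof -
      have "\<bar>K z y - h \<alpha> z\<bar> \<le> (D z + 1) / w z * mdist M (\<iota> y) \<alpha>" using \<alpha>M by (rule kernel_ext_lipschitz)
      also have "\<dots> < (D z + 1) / w z * (s / 2 * w z / (D z + 1))"
        using y r_le(3)[OF that] w_positive[of z] D_nonneg[of z]
        by (intro mult_strict_left_mono) (auto simp: add_nonneg_pos)
      also have "\<dots> = s / 2" using w_positive[of z] D_nonneg[of z]
        by (simp add: field_simps add_nonneg_eq_0_iff)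
      finally show ?thesis .
    qed
    have "\<forall>\<^sub>F n in sequentially. \<forall>z\<in>F. \<bar>K z (a n) - h \<alpha> z\<bar> < s / 2 \<and> a n \<noteq> z"
    proof (intro eventually_ball_finite F(1) ballI eventually_conj leaves)
      fix z
      show "\<forall>\<^sub>F n in sequentially. \<bar>K z (a n) - h \<alpha> z\<bar> < s / 2"
        using tendstoD[OF lim, of "s / 2"] s by (simp add: dist_real_def)
    qed
    then show ?thesis
    proof eventually_elim
      case (elim n)
      have term_le: "dist_term (a n) y z \<le> w z * s" if z: "z \<in> F" for z
      proof -
        have "\<bar>K z (a n) - K z y\<bar> \<le> s" using elim[rule_format, OF z] Ky[OF z] by linarith
        moreover have "z \<noteq> a n" "z \<noteq> y" using elim z \<open>y \<notin> F\<close> by auto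
        ultimately have "dist_term (a n) y z \<le> w z * s / (D z + 1)"
          unfolding dist_term_def using w_positive[of z] D_nonneg[of z]
          by (intro divide_right_mono mult_left_mono) auto
        also have "\<dots> \<le> w z * s / 1"
          using w_positive[of z] D_nonneg[of z] s by (intro divide_left_mono) auto
        finally show ?thesis by simp
      qed
      have "mdist M (\<iota> (a n)) (\<iota> y) = infsum (dist_term (a n) y) F + infsum (dist_term (a n) y) (- F)"
        unfolding mdist_embedded
        by (subst infsum_Un_disjoint[symmetric]) (auto intro: dist_term_summable simp: Un_commute)
      also have "infsum (dist_term (a n) y) F \<le> (\<Sum>z\<in>F. w z * s)"
        using F(1) term_le by (simp add: sum_mono)
      also have "(\<Sum>z\<in>F. w z * s) \<le> e / 3"
      proof -
        have "sum w F * s \<le> (sum w F + 1) * s" using s by (simp add: mult_right_mono)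
        also have "\<dots> = e / 3"
        proof -
          have "A * (e / (3 * A)) = e / 3" if "A \<noteq> 0" for A using that by simp
          then show ?thesis unfolding s_def using wF by (metis add_nonneg_eq_0_iff zero_le_one zero_neq_one)
        qed
        finally show ?thesis by (simp add: sum_distrib_right)
      qed
      also have "infsum (dist_term (a n) y) (- F) \<le> infsum w (- F)"
        using w_summable
        by (intro infsum_mono dist_term_summable dist_term_le) (auto intro: summable_on_subset_banach)
      finally have "mdist M (\<iota> (a n)) (\<iota> y) < 2 * e / 3" using tail by simp
      moreover have "mdist M (\<iota> (a n)) \<alpha> \<le> mdist M (\<iota> (a n)) (\<iota> y) + mdist M (\<iota> y) \<alpha>"
        using \<alpha>M by (intro mdist_triangle) auto
      ultimately show ?case using y r_le(1) by linarith
    qed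
  qed
  then show ?thesis
    using \<alpha>M by (simp add: mtopology_of_def Metric_space.limitin_metric)
qed

end

section \<open>The measure Q and visits to a set of states\<close>

lemma natural_filtration_coordinate:
  assumes "j \<le> k"
  shows "(\<lambda>X. X j) \<in> natural_filtration k \<rightarrow>\<^sub>M count_space UNIV"
proof (rule measurableI)
  fix A :: "'a set"
  have "{X. X j \<in> A} \<in> sets (natural_filtration k)"
    unfolding natural_filtration_def using assms by (subst sets_measure_of) auto
  then show "(\<lambda>X. X j) -` A \<inter> space (natural_filtration k) \<in> sets (natural_filtration k)"
    by (simp add: natural_filtration_def vimage_def)
qed simp

context killed_chain
begin

text \<open>
The event is decomposed by the first time \<open>k \<ge> n\<close> at which \<open>B\<close> is visited. The defining property of \<open>Q\<close>
turns its part \<open>first k\<close> into an integral of \<open>h (X k) = reduced h B (X k)\<close> under \<open>P x\<close>. Since the reduced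
function is superharmonic for the killed kernel, its integral over the paths that have met neither \<open>x0\<close>
nor \<open>B\<close> so far pays for all these parts: the sum telescopes (\<open>V_step\<close>).
\<close>

lemma escape_through_set_le:
  assumes Q: "is_Q P x0 (\<lambda>y. c * h y * of_bool (y \<noteq> x0)) x Q" and "0 \<le> c"
    and h: "transient_harmonic (killed p x0) h"
  shows "emeasure Q {X. (\<forall>k\<ge>n. X k \<noteq> x0) \<and> (\<exists>k\<ge>n. X k \<in> B)}
       \<le> ennreal (c * (full.T ^^ n) (killed.reduced h B) x)"
proof -
  interpret transient_harmonic "killed p x0" h by (rule h)
  define \<phi> where "\<phi> = (\<lambda>y. c * h y * of_bool (y \<noteq> x0))"
  define r where "r = (\<lambda>y. c * killed.reduced h B y)"
  define before where "before = (\<lambda>k (X :: nat \<Rightarrow> 'a). \<forall>j. n \<le> j \<and> j < k \<longrightarrow> X j \<notin> insert x0 B)"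
  define V where "V = (\<lambda>k g. \<integral>\<^sup>+X. of_bool (before k X) * ennreal (g (X k)) \<partial>P x)"
  define first where "first = (\<lambda>k. {X. before k X \<and> X k \<in> B \<and> (\<forall>j\<ge>k. X j \<noteq> x0)})"
  have setsQ: "sets Q = sets path_space" using Q by (simp add: is_Q_def)
  have spaceQ: "space Q = UNIV"
    using sets_eq_imp_space_eq[OF setsQ] by (simp add: path_space_def space_PiM)
  note [measurable] = path_coordinate_measurable[OF setsQ]
  have first_sets: "first k \<in> sets Q" for k
  proof -
    have "{X \<in> space Q. (\<forall>j. n \<le> j \<and> j < k \<longrightarrow> X j \<notin> insert x0 B) \<and> X k \<in> B \<and> (\<forall>j. j \<ge> k \<longrightarrow> X j \<noteq> x0)} \<in> sets Q"
      by measurable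
    then show ?thesis by (simp add: first_def before_def spaceQ)
  qed
  have r_nonneg: "0 \<le> r y" for y unfolding r_def using \<open>0 \<le> c\<close> by (simp add: reduced_nonneg)
  have r_on: "r y = c * h y" if "y \<in> B" for y using that by (simp add: r_def reduced_on)
  have r_super: "killed.T r y \<le> r y" for y
    unfolding r_def killed.T_cmult using \<open>0 \<le> c\<close> by (intro mult_left_mono reduced_superharmonic)
  have before_cong: "before k X = before k Y" if "\<forall>j<k. X j = Y j" for k X Y
    using that by (auto simp: before_def)
  have V_meas: "(\<lambda>X. of_bool (before k X) * ennreal (g (X k))) \<in> borel_measurable (P x)" for k g
  proof (rule adapted_measurable[of k, OF _ sets_P])
    have "of_bool (before k X) * ennreal (g (X k)) = of_bool (before k Y) * ennreal (g (Y k))"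
      if "\<forall>i\<le>k. X i = Y i" for X Y
      using that before_cong[of k X Y] by simp
    then show "adapted k (\<lambda>X. of_bool (before k X) * ennreal (g (X k)))"
      unfolding adapted_def by blast
  qed
  have first_eq: "emeasure Q (first k) = V k (\<lambda>y. of_bool (y \<in> B) * \<phi> y)" for k
  proof -
    let ?F = "\<lambda>X. indicator {X. before k X \<and> X k \<in> B} X :: ennreal"
    have "{X \<in> space (natural_filtration k). (\<forall>j\<in>{n..<k}. X j \<in> - insert x0 B) \<and> X k \<in> B}
        \<in> sets (natural_filtration k)"
      by (intro sets.sets_Collect_conj sets.sets_Collect_finite_All
          measurable_sets_Collect[OF natural_filtration_coordinate]) auto
    then have "?F \<in> borel_measurable (natural_filtration k)"
      by (intro borel_measurable_indicator)
        (simp add: before_def natural_filtration_def Ball_def)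
    then have "(\<integral>\<^sup>+X. ?F X * indicator {X. \<forall>j\<ge>k. X j \<noteq> x0} X \<partial>Q) = (\<integral>\<^sup>+X. ?F X * ennreal (\<phi> (X k)) \<partial>P x)"
      using Q unfolding is_Q_def \<phi>_def by blast
    moreover have "(\<integral>\<^sup>+X. ?F X * indicator {X. \<forall>j\<ge>k. X j \<noteq> x0} X \<partial>Q) = (\<integral>\<^sup>+X. indicator (first k) X \<partial>Q)"
      by (intro nn_integral_cong) (auto simp: first_def indicator_def)
    moreover have "(\<integral>\<^sup>+X. ?F X * ennreal (\<phi> (X k)) \<partial>P x) = V k (\<lambda>y. of_bool (y \<in> B) * \<phi> y)"
      unfolding V_def by (intro nn_integral_cong) (auto simp: indicator_def)
    ultimately show ?thesis using first_sets by simp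
  qed
  have V_step: "V k (\<lambda>y. of_bool (y \<in> B) * \<phi> y) + V (Suc k) (\<lambda>y. of_bool (y \<noteq> x0) * r y)
      \<le> V k (\<lambda>y. of_bool (y \<noteq> x0) * r y)" if "n \<le> k" for k
  proof -
    let ?out = "\<lambda>y. of_bool (y \<notin> insert x0 B) * r y"
    have "before (Suc k) X = before (Suc k) Y" if "\<forall>i\<le>k. X i = Y i" for X Y
      using that by (intro before_cong) (simp add: less_Suc_eq_le)
    then have "adapted k (\<lambda>X. of_bool (before (Suc k) X) :: ennreal)"
      unfolding adapted_def by (intro allI impI arg_cong[where f = of_bool]) blast
    then have "V (Suc k) (\<lambda>y. of_bool (y \<noteq> x0) * r y)
        = (\<integral>\<^sup>+X. of_bool (before (Suc k) X) * ennreal (killed.T r (X k)) \<partial>P x)"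
      unfolding V_def killed_T_eq_full_T using r_nonneg by (intro markov_step) auto
    also have "\<dots> \<le> (\<integral>\<^sup>+X. of_bool (before (Suc k) X) * ennreal (r (X k)) \<partial>P x)"
      by (intro nn_integral_mono mult_left_mono ennreal_leI r_super) auto
    also have "\<dots> = V k ?out"
      unfolding V_def using that by (intro nn_integral_cong) (auto simp: before_def less_Suc_eq)
    finally have "V k (\<lambda>y. of_bool (y \<in> B) * \<phi> y) + V (Suc k) (\<lambda>y. of_bool (y \<noteq> x0) * r y)
        \<le> V k (\<lambda>y. of_bool (y \<in> B) * \<phi> y) + V k ?out"
      by (rule add_left_mono)
    also have "\<dots> = V k (\<lambda>y. of_bool (y \<noteq> x0) * r y)"
    proof -
      have "V k (\<lambda>y. of_bool (y \<in> B) * \<phi> y) + V k ?out = (\<integral>\<^sup>+X. of_bool (before k X) *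
          ennreal (of_bool (X k \<in> B) * \<phi> (X k)) + of_bool (before k X) * ennreal (?out (X k)) \<partial>P x)"
        unfolding V_def
        using V_meas[of k "\<lambda>y. of_bool (y \<in> B) * \<phi> y"] V_meas[of k ?out]
        by (rule nn_integral_add[symmetric])
      also have "\<dots> = V k (\<lambda>y. of_bool (y \<noteq> x0) * r y)"
        unfolding V_def by (intro nn_integral_cong) (auto simp: \<phi>_def r_on)
      finally show ?thesis .
    qed
    finally show ?thesis .
  qed
  have V_start: "V n (\<lambda>y. of_bool (y \<noteq> x0) * r y) \<le> ennreal (c * (full.T ^^ n) (killed.reduced h B) x)"
  proof -
    have "V n (\<lambda>y. of_bool (y \<noteq> x0) * r y) \<le> (\<integral>\<^sup>+X. ennreal (r (X n)) \<partial>P x)"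
      unfolding V_def using r_nonneg
      by (intro nn_integral_mono) (auto simp: before_def)
    also have "\<dots> = ennreal ((full.T ^^ n) r x)"
      using r_nonneg by (rule nn_integral_coordinate)
    finally show ?thesis unfolding r_def by (simp add: full.iterate_cmult)
  qed
  have partial: "(\<Sum>i<m. emeasure Q (first (n + i))) + V (n + m) (\<lambda>y. of_bool (y \<noteq> x0) * r y)
      \<le> V n (\<lambda>y. of_bool (y \<noteq> x0) * r y)" for m
  proof (induction m)
    case (Suc m)
    have "(\<Sum>i<Suc m. emeasure Q (first (n + i))) + V (n + Suc m) (\<lambda>y. of_bool (y \<noteq> x0) * r y)
        = (\<Sum>i<m. emeasure Q (first (n + i)))
          + (V (n + m) (\<lambda>y. of_bool (y \<in> B) * \<phi> y) + V (Suc (n + m)) (\<lambda>y. of_bool (y \<noteq> x0) * r y))"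
      by (simp add: first_eq add.assoc)
    also have "\<dots> \<le> (\<Sum>i<m. emeasure Q (first (n + i))) + V (n + m) (\<lambda>y. of_bool (y \<noteq> x0) * r y)"
      by (intro add_left_mono V_step) simp
    also note Suc
    finally show ?case .
  qed simp
  have "{X. (\<forall>k\<ge>n. X k \<noteq> x0) \<and> (\<exists>k\<ge>n. X k \<in> B)} \<subseteq> (\<Union>i. first (n + i))"
  proof safe
    fix X k assume X: "\<forall>k\<ge>n. X k \<noteq> x0" "n \<le> k" "X k \<in> B"
    define m where "m = (LEAST k. n \<le> k \<and> X k \<in> B)"
    have m: "n \<le> m \<and> X m \<in> B" unfolding m_def by (rule LeastI[of _ k]) (use X in simp)
    have "X j \<notin> B" if "n \<le> j" "j < m" for j using not_less_Least[of j] that unfolding m_def by blast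
    then have "X \<in> first (n + (m - n))" using X m by (auto simp: first_def before_def)
    then show "X \<in> (\<Union>i. first (n + i))" by blast
  qed
  then have "emeasure Q {X. (\<forall>k\<ge>n. X k \<noteq> x0) \<and> (\<exists>k\<ge>n. X k \<in> B)} \<le> emeasure Q (\<Union>i. first (n + i))"
    using first_sets by (intro emeasure_mono) auto
  also have "\<dots> \<le> (\<Sum>i. emeasure Q (first (n + i)))"
    using first_sets by (intro emeasure_subadditive_countably) auto
  also have "\<dots> \<le> V n (\<lambda>y. of_bool (y \<noteq> x0) * r y)"
  proof (rule suminf_le_const)
    show "(\<Sum>i<m. emeasure Q (first (n + i))) \<le> V n (\<lambda>y. of_bool (y \<noteq> x0) * r y)" for m
      using partial[of m] by (rule order_trans[rotated]) simp
  qed simp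
  also note V_start
  finally show ?thesis .
qed

lemma AE_finitely_many_visits:
  assumes Q: "is_Q P x0 \<phi> x Q"
  shows "AE X in Q. \<forall>y. finite {k. X k = y}"
proof -
  have setsQ: "sets Q = sets path_space" using Q by (simp add: is_Q_def)
  note [measurable] = path_coordinate_measurable[OF setsQ]
  have "AE X in Q. finite {k. X k = y}" for y
  proof (rule AE_I)
    show "emeasure Q {X \<in> space Q. infinite {n. 1 \<le> n \<and> X n = y}} = 0"
      using Q by (simp add: is_Q_def)
    show "{X \<in> space Q. infinite {n. 1 \<le> n \<and> X n = y}} \<in> sets Q" by measurable
    have "finite {k. X k = y}" if "finite {n. 1 \<le> n \<and> X n = y}" for X :: "nat \<Rightarrow> 'a"
      by (rule finite_subset[of _ "insert 0 {n. 1 \<le> n \<and> X n = y}"]) (use that in auto)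
    then show "{X \<in> space Q. \<not> finite {k. X k = y}} \<subseteq> {X \<in> space Q. infinite {n. 1 \<le> n \<and> X n = y}}"
      by blast
  qed
  then show ?thesis by (simp add: AE_all_countable)
qed

text \<open>
Here \<open>B N\<close> is \<open>C\<close> without the first \<open>N\<close> states. A trajectory that is finally away from \<open>x0\<close> and enters \<open>C\<close>
infinitely often enters every \<open>B N\<close> after that time, as it visits each state only finitely often; and
the \<open>Q\<close>-measure of this event tends to \<open>0\<close> as \<open>N\<close> grows.
\<close>

lemma AE_thin_set:
  assumes Q: "is_Q P x0 (\<lambda>y. c * h y * of_bool (y \<noteq> x0)) x Q" and "0 \<le> c"
    and h: "transient_harmonic (killed p x0) h"
    and minimal: "minimal_killed_harmonic p x0 h"
    and le: "\<And>y. y \<in> C \<Longrightarrow> a * killed.G u y \<le> b * killed.G v y" "0 \<le> a" "0 \<le> b"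
    and gap: "b * h v < a * h u"
  shows "AE X in Q. finite {k. X k \<in> C}"
proof -
  interpret transient_harmonic "killed p x0" h by (rule h)
  define B where "B = (\<lambda>N. C - to_nat -` {..<N})"
  have setsQ: "sets Q = sets path_space" using Q by (simp add: is_Q_def)
  have spaceQ: "space Q = UNIV"
    using sets_eq_imp_space_eq[OF setsQ] by (simp add: path_space_def space_PiM)
  note [measurable] = path_coordinate_measurable[OF setsQ]
  have reduced_lim: "(\<lambda>N. killed.reduced h (B N) y) \<longlonglongrightarrow> 0" for y
  proof (rule minimal_reduced_tendsto_0[OF _ _ _ _ le gap])
    show "\<exists>c\<ge>0. \<forall>x. \<psi> x = c * h x"
      if "\<And>x. killed.T \<psi> x = \<psi> x" "\<And>x. 0 \<le> \<psi> x" "\<And>x. \<psi> x \<le> h x" for \<psi>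
    proof -
      have "killed_harmonic p x0 \<psi>"
        unfolding killed_harmonic_def killed_T_eq[symmetric] by (simp add: that(1))
      then have "\<exists>c\<in>{0..1}. \<forall>x. \<psi> x = c * h x"
        using minimal that(2,3) unfolding minimal_killed_harmonic_def by blast
      then show ?thesis by (meson atLeastAtMost_iff)
    qed
    show "decseq B" by (rule decseq_SucI) (auto simp: B_def)
    show "\<exists>N. y \<notin> B N" for y by (rule exI[of _ "Suc (to_nat y)"]) (simp add: B_def)
    show "B N \<subseteq> C" for N by (auto simp: B_def)
  qed
  have null: "AE X in Q. \<not> (\<forall>N. (\<forall>k\<ge>n. X k \<noteq> x0) \<and> (\<exists>k\<ge>n. X k \<in> B N))" for n
  proof -
    let ?E = "\<lambda>N. {X. (\<forall>k\<ge>n. X k \<noteq> x0) \<and> (\<exists>k\<ge>n. X k \<in> B N)}"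
    have "{X \<in> space Q. \<forall>N. (\<forall>k. k \<ge> n \<longrightarrow> X k \<noteq> x0) \<and> (\<exists>k. k \<ge> n \<and> X k \<in> B N)} \<in> sets Q" by measurable
    then have meas: "(\<Inter>N. ?E N) \<in> sets Q" by (simp add: spaceQ Collect_all_eq[symmetric])
    have "{X \<in> space Q. (\<forall>k. k \<ge> n \<longrightarrow> X k \<noteq> x0) \<and> (\<exists>k. k \<ge> n \<and> X k \<in> B N)} \<in> sets Q" for N by measurable
    then have measE: "?E N \<in> sets Q" for N by (simp add: spaceQ)
    have "emeasure Q (\<Inter>N. ?E N) \<le> ennreal (c * (full.T ^^ n) (killed.reduced h (B N)) x)" for N
      by (rule order_trans[OF emeasure_mono escape_through_set_le[OF Q \<open>0 \<le> c\<close> h]]) (use measE in auto)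
    moreover have "(\<lambda>N. ennreal (c * (full.T ^^ n) (killed.reduced h (B N)) x)) \<longlonglongrightarrow> ennreal (c * (full.T ^^ n) (\<lambda>_. 0) x)"
      by (intro tendsto_ennrealI tendsto_mult_left full.tendsto_iterate reduced_lim)
    moreover have "(full.T ^^ n) (\<lambda>_. 0) x = 0"
      using full.iterate_cmult[of n 0 "\<lambda>_. 0" x] by simp
    ultimately have "emeasure Q (\<Inter>N. ?E N) \<le> 0"
      by (intro LIMSEQ_le_const) auto
    then show ?thesis using meas by (intro AE_I[of _ _ "\<Inter>N. ?E N"]) auto
  qed
  have "AE X in Q. \<forall>n. \<not> (\<forall>N. (\<forall>k\<ge>n. X k \<noteq> x0) \<and> (\<exists>k\<ge>n. X k \<in> B N))"
    using null by (simp add: AE_all_countable)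
  with AE_finitely_many_visits[OF Q] show ?thesis
  proof eventually_elim
    case (elim X)
    obtain n where "\<forall>k\<in>{k. X k = x0}. k < n"
      using elim(1) finite_nat_set_iff_bounded by blast
    then have "\<forall>k\<ge>n. X k \<noteq> x0" by auto
    with elim(2) obtain N where N: "\<And>k. n \<le> k \<Longrightarrow> X k \<notin> B N" by blast
    have "{k. X k \<in> C} \<subseteq> {..<n} \<union> (\<Union>y\<in>to_nat -` {..<N}. {k. X k = y})"
    proof
      fix k assume k: "k \<in> {k. X k \<in> C}"
      show "k \<in> {..<n} \<union> (\<Union>y\<in>to_nat -` {..<N}. {k. X k = y})"
        using k N[of k] by (cases "k < n") (auto simp: B_def)
    qed
    moreover have "finite (to_nat -` {..<N} :: 'a set)" by (intro finite_vimageI) auto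
    ultimately show ?case using elim(1) by (elim finite_subset) auto
  qed
qed

end


section \<open>Convergence to the boundary point\<close>

theorem proposition4p1:
  fixes p :: "'a::countable \<Rightarrow> 'a \<Rightarrow> real"
    and P :: "'a \<Rightarrow> (nat \<Rightarrow> 'a) measure"
    and \<beta> :: "'a \<Rightarrow> real"
    and x0 :: 'a
    and w :: "'a \<Rightarrow> real"
    and M :: "'b metric"
    and \<iota> :: "'a \<Rightarrow> 'b"
    and x :: 'a
    and \<alpha> :: 'b
    and Q :: "(nat \<Rightarrow> 'a) measure"
  assumes "recurrent_chain p P"
    and "stationary_measure p \<beta>"
    and "\<And>z. w z > 0" and "w summable_on UNIV"
    and "is_completion (martin_dist P x0 w) M \<iota>"
    and "\<alpha> \<in> minimal_boundary p P x0 M \<iota>"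
    and "is_Q P x0 (boundary_fun P \<beta> x0 M \<iota> \<alpha>) x Q"
  shows "AE X in Q. limitin (mtopology_of M) (\<lambda>n. \<iota> (X n)) \<alpha> sequentially"
proof -
  interpret martin_completion p P x0 \<beta> w M \<iota>
    by (rule martin_completion.intro[OF killed_chain.intro[OF assms(1) killed_chain_axioms.intro[OF assms(2)]]
          martin_completion_axioms.intro[OF assms(3-5)]])
  have boundary: "\<alpha> \<in> martin_boundary M \<iota>" and minimal: "minimal_killed_harmonic p x0 (h \<alpha>)"
    using assms(6) unfolding minimal_boundary_def by blast+
  have \<alpha>: "\<alpha> \<in> mspace M" using boundary by (simp add: martin_boundary_def)
  have harmonic: "transient_harmonic (killed p x0) (h \<alpha>)"
  proof (intro transient_harmonic.intro kernel_harmonic.intro kernel_harmonic_axioms.intro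
      killed.transient_kernel_axioms killed.finite_range_kernel_axioms)
    show "killed.T (h \<alpha>) z = h \<alpha> z" for z
      using minimal unfolding minimal_killed_harmonic_def killed_harmonic_def killed_T_eq by metis
  qed (rule kernel_ext_nonneg[OF \<alpha>])
  have Q: "is_Q P x0 (\<lambda>y. 1 / \<beta> x0 * h \<alpha> y * of_bool (y \<noteq> x0)) x Q"
    using assms(7) by (simp add: boundary_fun_def[abs_def])
  have \<beta>: "0 \<le> 1 / \<beta> x0" using stationary_nonneg by simp
  \<comment> \<open>the states where \<open>K z\<close> is too large, respectively too small, are visited finitely often\<close>
  have upper: "AE X in Q. finite {k. X k \<in> {y. a \<le> K z y}}" if a: "h \<alpha> z < a" for z a
  proof (rule AE_thin_set[OF Q \<beta> harmonic minimal, where u = x0 and v = z and a = a and b = 1])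
    show "a * killed.G x0 y \<le> 1 * killed.G z y" if "y \<in> {y. a \<le> K z y}" for y
      using mult_right_mono[of a "K z y", OF _ killed.G_nonneg[of x0 y]] that
      by (simp add: martin_kernel_mult)
    show "0 \<le> a" using a kernel_ext_nonneg[OF \<alpha>, of z] by linarith
    show "1 * h \<alpha> z < a * h \<alpha> x0" unfolding kernel_ext_x0[OF \<alpha>] using a by simp
  qed (rule zero_le_one)
  have lower: "AE X in Q. finite {k. X k \<in> {y. K z y \<le> a}}" if a: "a < h \<alpha> z" for z a
  proof (cases "0 \<le> a")
    case True
    show ?thesis
    proof (rule AE_thin_set[OF Q \<beta> harmonic minimal, where u = z and v = x0 and a = 1 and b = a])
      show "1 * killed.G z y \<le> a * killed.G x0 y" if "y \<in> {y. K z y \<le> a}" for y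
        using mult_right_mono[of "K z y" a, OF _ killed.G_nonneg[of x0 y]] that
        by (simp add: martin_kernel_mult)
      show "a * h \<alpha> x0 < 1 * h \<alpha> z" unfolding kernel_ext_x0[OF \<alpha>] using a by simp
    qed (rule zero_le_one, rule True)
  next
    case False
    then have "a < K z y" for y using martin_kernel_nonneg[of z y] by linarith
    then have "{y. K z y \<le> a} = {}" by (auto simp: not_le)
    then show ?thesis by simp
  qed
  have "AE X in Q. h \<alpha> z < of_rat a \<longrightarrow> finite {k. X k \<in> {y. of_rat a \<le> K z y}}" for z and a :: rat
    by (rule AE_impI) (rule upper)
  then have "AE X in Q. \<forall>z. \<forall>a::rat. h \<alpha> z < of_rat a \<longrightarrow> finite {k. X k \<in> {y. of_rat a \<le> K z y}}"
    unfolding AE_all_countable by blast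
  moreover have "AE X in Q. of_rat a < h \<alpha> z \<longrightarrow> finite {k. X k \<in> {y. K z y \<le> of_rat a}}"
    for z and a :: rat
    by (rule AE_impI) (rule lower)
  then have "AE X in Q. \<forall>z. \<forall>a::rat. of_rat a < h \<alpha> z \<longrightarrow> finite {k. X k \<in> {y. K z y \<le> of_rat a}}"
    unfolding AE_all_countable by blast
  moreover note AE_finitely_many_visits[OF Q]
  ultimately show ?thesis
  proof eventually_elim
    case (elim X)
    show ?case
    proof (rule limitin_boundary_point[OF boundary])
      show "\<forall>\<^sub>F n in sequentially. X n \<noteq> y" for y
        using elim(3) unfolding cofinite_eq_sequentially[symmetric] eventually_cofinite by simp
      show "(\<lambda>n. K z (X n)) \<longlonglongrightarrow> h \<alpha> z" for z
      proof (rule order_tendstoI)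
        fix b assume "b < h \<alpha> z"
        then obtain a where a: "b < of_rat a" "of_rat a < h \<alpha> z" using of_rat_dense by blast
        then have "finite {n. \<not> of_rat a < K z (X n)}" using elim(2) by (simp add: not_less)
        then have "\<forall>\<^sub>F n in sequentially. of_rat a < K z (X n)"
          unfolding cofinite_eq_sequentially[symmetric] eventually_cofinite .
        then show "\<forall>\<^sub>F n in sequentially. b < K z (X n)"
          by eventually_elim (use a in linarith)
      next
        fix b assume "h \<alpha> z < b"
        then obtain a where a: "h \<alpha> z < of_rat a" "of_rat a < b" using of_rat_dense by blast
        then have "finite {n. \<not> K z (X n) < of_rat a}" using elim(1) by (simp add: not_less)
        then have "\<forall>\<^sub>F n in sequentially. K z (X n) < of_rat a"
          unfolding cofinite_eq_sequentially[symmetric] eventually_cofinite .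
        then show "\<forall>\<^sub>F n in sequentially. K z (X n) < b"
          by eventually_elim (use a in linarith)
      qed
    qed
  qed
qed

end
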